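(* Fix an integer $k\ge3$ and a constant $0<c<c_k$. There exists a constant $t^{\dagger}=t^{\dagger}(c)$ such that, in the $k$-peeling process $(G_t)_{t\ge0}$ on $G\sim\mathcal{G}(n,c/n)$, with high probability every connected component of $G_{t^{\dagger}}$ has $o(\log^3 n)$ vertices.
   Context: $\mathcal{G}(n,p)$ is the binomial random graph on $n$ vertices with independent edge probability $p$; "with high probability" means with probability tending to $1$ as $n\to\infty$. The $k$-peeling process on a graph $G$: $G_0=G$, and for $t\ge0$ the graph $G_{t+1}$ is obtained from $G_t$ by deleting all edges incident with vertices of degree at most $k-1$ in $G_t$ (vertices are never deleted, so every $G_t$ has the same $n$ vertices, some possibly isolated). For $c>0$ let $\beta(c)$ be the largest $x\in[0,1]$ with $x=\Pr[\mathrm{Poisson}(cx)\ge k-1]$, and $c_k=\inf\{c>0:\beta(c)>0\}$ (the threshold for a nonempty $k$-core in $\mathcal{G}(n,c/n)$). *)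

theory Defs
  imports "HOL-Probability.Probability" "HOL-Library.Landau_Symbols"
begin

text \<open>
  A simple graph on a vertex set \<open>V\<close> is given by its set of edges, each edge being a two-element
  subset of \<open>V\<close>.
\<close>

definition all_edges :: "'a set \<Rightarrow> 'a set set" where
  "all_edges V = {e. e \<subseteq> V \<and> card e = 2}"

definition gnp :: "nat \<Rightarrow> real \<Rightarrow> nat set set pmf" where
  "gnp n p = map_pmf (\<lambda>b. {e \<in> all_edges {..<n}. b e})
     (Pi_pmf (all_edges {..<n}) False (\<lambda>_. bernoulli_pmf p))"

definition vertex_degree :: "'a set set \<Rightarrow> 'a \<Rightarrow> nat" where
  "vertex_degree E v = card {e \<in> E. v \<in> e}"

definition peel_step :: "nat \<Rightarrow> 'a set set \<Rightarrow> 'a set set" where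
  "peel_step k E = E - {e \<in> E. \<exists>v\<in>e. vertex_degree E v \<le> k - 1}"

primrec peel :: "nat \<Rightarrow> 'a set set \<Rightarrow> nat \<Rightarrow> 'a set set" where
  "peel k E 0 = E"
| "peel k E (Suc t) = peel_step k (peel k E t)"

text \<open>
  The vertex sets of the connected components, as equivalence classes of reachability. Isolated
  vertices form singleton components.
\<close>

definition graph_components :: "'a set \<Rightarrow> 'a set set \<Rightarrow> 'a set set" where
  "graph_components V E = V // ({(u, v). {u, v} \<in> E}\<^sup>*)"

text \<open>
  The library's \<^const>\<open>poisson_pmf\<close> is only specified for positive rates; the Poisson distribution
  with rate \<open>0\<close> is the point mass at \<open>0\<close>.
\<close>

definition poisson0_pmf :: "real \<Rightarrow> nat pmf" where
  "poisson0_pmf r = (if r > 0 then poisson_pmf r else return_pmf 0)"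

definition core_beta :: "nat \<Rightarrow> real \<Rightarrow> real" where
  "core_beta k c = (GREATEST x. x \<in> {0..1} \<and>
     x = measure_pmf.prob (poisson0_pmf (c * x)) {j. j \<ge> k - 1})"

definition core_threshold :: "nat \<Rightarrow> real" where
  "core_threshold k = Inf {c. c > 0 \<and> core_beta k c > 0}"

end

theory Submission
  imports Defs "HOL-Real_Asymp.Real_Asymp"
begin

text \<open>
  Let \<open>s \<approx> log n\<close>. A component of \<open>G\<^sub>t\<^sub>+\<^sub>1\<close> with at least \<open>s\<close> vertices contains a tree \<open>T\<close> on exactly
  \<open>s\<close> vertices. At least half of the vertices of \<open>T\<close> have degree at most \<open>2 < k\<close> in \<open>T\<close>, so each of
  them has a further neighbour surviving \<open>t\<close> rounds of peeling; locally this survival is witnessed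
  by a \<open>(k - 1)\<close>-ary tree of depth \<open>t\<close>. Witnesses can overlap each other or \<open>T\<close> only where the
  union of \<open>T\<close> and the witnesses has a cycle. That union is connected with \<open>O(log n)\<close> vertices, and
  with high probability no such subgraph of \<open>\<G>(n, c/n)\<close> has more than a constant number \<open>m\<close> of
  independent cycles. Hence all but \<open>2m\<close> of the low-degree vertices have pairwise disjoint
  witnesses.

  By the van den Berg--Kesten inequality a given tree occurs with disjoint witnesses at \<open>j\<close> given
  vertices with probability at most \<open>(c/n)\<^bsup>s-1\<^esup> (c \<lambda>\<^sub>t)\<^bsup>j\<^esup>\<close>, where \<open>\<lambda>\<^sub>t\<close> bounds the probability
  that a vertex is the root of a tree witness. A more general form of the inequality gives
  \<open>\<lambda>\<^sub>t\<^sub>+\<^sub>1 \<le> Pr[Bin(n, c \<lambda>\<^sub>t / n) \<ge> k - 1]\<close>, so \<open>\<lambda>\<^sub>t\<close> is governed by the iteration of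
  \<open>x \<mapsto> Pr[Poisson(cx) \<ge> k - 1]\<close> from \<open>1\<close>, which tends to \<open>0\<close> because \<open>c < c\<^sub>k\<close>. As there are
  at most \<open>n\<^bsup>s\<^esup> 4\<^bsup>s\<^esup>\<close> breadth-first codes of trees, a first moment bound finishes the proof once
  \<open>c \<lambda>\<^sub>t\<close> is small enough.
\<close>

section \<open>Disjoint occurrence\<close>

text \<open>The law behind \<open>gnp\<close> over an arbitrary ground set, so that inequalities can
  be proved by adding one coordinate at a time.\<close>

definition random_subset :: "'a set \<Rightarrow> real \<Rightarrow> 'a set pmf" where
  "random_subset A p =
     map_pmf (\<lambda>b. {e \<in> A. b e}) (Pi_pmf A False (\<lambda>_. bernoulli_pmf p))"

definition occurs :: "'a set set \<Rightarrow> 'a set \<Rightarrow> bool" where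
  "occurs \<W> E \<longleftrightarrow> (\<exists>W\<in>\<W>. W \<subseteq> E)"

text \<open>\<open>\<J>\<close> lists the admissible index sets: \<open>{J}\<close> demands all
  events of \<open>J\<close>, while the sets with at least \<open>m\<close> elements express that
  some \<open>m\<close> events occur disjointly.\<close>

definition occur_disjointly :: "'i set set \<Rightarrow> ('i \<Rightarrow> 'a set set) \<Rightarrow> 'a set \<Rightarrow> bool" where
  "occur_disjointly \<J> \<W> E \<longleftrightarrow>
     (\<exists>J\<in>\<J>. \<exists>W. (\<forall>j\<in>J. W j \<in> \<W> j \<and> W j \<subseteq> E) \<and> disjoint_family_on W J)"

section \<open>Mixtures of Bernoulli variables and random subsets\<close>

lemma prob_bind_pmf_mono:
  assumes "\<And>x. x \<in> set_pmf M \<Longrightarrow> measure_pmf.prob (N x) A \<le> measure_pmf.prob (N' x) B"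
  shows "measure_pmf.prob (bind_pmf M N) A \<le> measure_pmf.prob (bind_pmf M N') B"
proof -
  have "emeasure (bind_pmf M N) A \<le> emeasure (bind_pmf M N') B"
    unfolding emeasure_bind_pmf
    by (intro nn_integral_mono_AE)
       (auto simp: AE_measure_pmf_iff measure_pmf.emeasure_eq_measure intro!: ennreal_leI assms)
  thus ?thesis
    by (simp add: measure_pmf.emeasure_eq_measure)
qed

lemma prob_bind_bernoulli:
  assumes "0 \<le> p" "p \<le> 1"
  shows "measure_pmf.prob (bind_pmf (bernoulli_pmf p) N) A =
           p * measure_pmf.prob (N True) A + (1 - p) * measure_pmf.prob (N False) A"
proof -
  have "emeasure (bind_pmf (bernoulli_pmf p) N) A =
      ennreal (p * measure_pmf.prob (N True) A + (1 - p) * measure_pmf.prob (N False) A)"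
    unfolding emeasure_bind_pmf using assms
    by (simp add: measure_pmf.emeasure_eq_measure ennreal_plus ennreal_mult mult.commute)
  thus ?thesis
    using assms by (simp add: measure_pmf.emeasure_eq_measure del: ennreal_plus)
qed

lemma bind_bernoulli_pmf_bernoulli:
  assumes "p \<in> {0..1}" "\<And>x. q x \<in> {0..1}"
  shows "bind_pmf (bernoulli_pmf p) (\<lambda>x. bernoulli_pmf (q x)) =
           bernoulli_pmf (p * q True + (1 - p) * q False)"
proof (rule pmf_eqI)
  fix y
  have q: "q True \<in> {0..1}" "q False \<in> {0..1}" using assms by blast+
  have r: "p * q True + (1 - p) * q False \<in> {0..1}"
    using convex_bound_le[of "q True" 1 "q False" p "1 - p"] assms(1) q by auto
  show "pmf (bind_pmf (bernoulli_pmf p) (\<lambda>x. bernoulli_pmf (q x))) y =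
      pmf (bernoulli_pmf (p * q True + (1 - p) * q False)) y"
    using assms(1) q r by (cases y) (simp_all add: pmf_bind algebra_simps)
qed

lemma bernoulli_pmf_0_1: "bernoulli_pmf 0 = return_pmf False" "bernoulli_pmf 1 = return_pmf True"
proof -
  have "pmf (bernoulli_pmf 0) x = pmf (return_pmf False) x"
    "pmf (bernoulli_pmf 1) x = pmf (return_pmf True) x" for x
    by (cases x; simp)+
  thus "bernoulli_pmf 0 = return_pmf False" "bernoulli_pmf 1 = return_pmf True"
    by (auto intro: pmf_eqI)
qed

lemma random_subset_empty: "random_subset {} p = return_pmf {}"
  by (simp add: random_subset_def)

lemma random_subset_insert:
  assumes "finite A" "e \<notin> A"
  shows "random_subset (insert e A) p =
    bind_pmf (bernoulli_pmf p) (\<lambda>x. map_pmf (\<lambda>E. if x then insert e E else E) (random_subset A p))"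
proof -
  have "{e' \<in> insert e A. (f(e := y)) e'} = (if y then insert e {e' \<in> A. f e'} else {e' \<in> A. f e'})"
    for f and y :: bool using assms(2) by auto
  thus ?thesis
    unfolding random_subset_def Pi_pmf_insert'[OF assms] map_pmf_def
    by (simp only: bind_assoc_pmf bind_return_pmf)
qed

lemma set_pmf_random_subset: "E \<in> set_pmf (random_subset A p) \<Longrightarrow> E \<subseteq> A"
  by (auto simp: random_subset_def)

lemma prob_random_subset_superset:
  assumes "finite A" "F \<subseteq> A" "0 \<le> p" "p \<le> 1"
  shows "measure_pmf.prob (random_subset A p) {E. F \<subseteq> E} = p ^ card F"
proof -
  have "(\<lambda>b. {e \<in> A. b e}) -` {E. F \<subseteq> E} = Pi A (\<lambda>e. if e \<in> F then {True} else UNIV)"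
    using assms(2) by (auto simp: Pi_def)
  hence "measure_pmf.prob (random_subset A p) {E. F \<subseteq> E} =
      (\<Prod>e\<in>A. measure_pmf.prob (bernoulli_pmf p) (if e \<in> F then {True} else UNIV))"
    unfolding random_subset_def using assms(1) by (simp add: measure_Pi_pmf_Pi)
  also have "\<dots> = (\<Prod>e\<in>A. if e \<in> F then p else 1)"
    using assms by (intro prod.cong) (auto simp: measure_pmf_single)
  also have "\<dots> = p ^ card F"
    using assms by (simp add: prod.If_cases Int_absorb1 flip: Int_def)
  finally show ?thesis .
qed

lemma prob_Pi_bernoulli_component:
  assumes "finite I" "j \<in> I" "0 \<le> p" "p \<le> 1"
  shows "measure_pmf.prob (Pi_pmf I False (\<lambda>_. bernoulli_pmf p)) {f. f j} = p"
proof -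
  have "measure_pmf.prob (Pi_pmf I False (\<lambda>_. bernoulli_pmf p)) {f. f j} =
      measure_pmf.prob (map_pmf (\<lambda>f. f j) (Pi_pmf I False (\<lambda>_. bernoulli_pmf p))) {True}"
    by (simp add: vimage_def)
  also have "\<dots> = p"
    using assms by (simp add: Pi_pmf_component measure_pmf_single)
  finally show ?thesis .
qed

text \<open>
  The van den Berg--Kesten inequality, in the form that replaces disjoint occurrence by
  independent copies of the underlying randomness, one copy for each index. The copies are
  introduced one coordinate at a time: a single shared coordinate \<open>e\<close> can serve at most one of the
  disjoint witnesses, so giving every index its own copy of \<open>e\<close> only helps.
\<close>

theorem occur_disjointly_le_independent:
  fixes \<W> :: "'i \<Rightarrow> 'a set set"
  assumes "finite A" "finite I" "0 \<le> p" "p \<le> 1" "\<J> \<subseteq> Pow I"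
    and up: "\<And>J J'. J \<in> \<J> \<Longrightarrow> J \<subseteq> J' \<Longrightarrow> J' \<subseteq> I \<Longrightarrow> J' \<in> \<J>"
  shows "measure_pmf.prob (random_subset A p) {E. occur_disjointly \<J> \<W> E} \<le>
    measure_pmf.prob
      (Pi_pmf I False (\<lambda>j. bernoulli_pmf (measure_pmf.prob (random_subset A p) {E. occurs (\<W> j) E})))
      {f. {j\<in>I. f j} \<in> \<J>}"
  using assms(1)
proof (induction A arbitrary: \<W> rule: finite_induct)
  case empty
  show ?case
  proof (cases "occur_disjointly \<J> \<W> {}")
    case True
    then obtain J where J: "J \<in> \<J>" "\<And>j. j \<in> J \<Longrightarrow> occurs (\<W> j) {}"
      unfolding occur_disjointly_def occurs_def by blast
    have eq: "(\<lambda>j. bernoulli_pmf (measure_pmf.prob (random_subset {} p) {E. occurs (\<W> j) E})) =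
        (\<lambda>j. return_pmf (occurs (\<W> j) {}))"
    proof
      fix j
      show "bernoulli_pmf (measure_pmf.prob (random_subset {} p) {E. occurs (\<W> j) E}) =
          return_pmf (occurs (\<W> j) {})"
        by (simp add: random_subset_empty indicator_def bernoulli_pmf_0_1)
    qed
    have "{j \<in> I. occurs (\<W> j) {}} \<in> \<J>"
      using J assms(5) by (intro up[OF J(1)]) auto
    hence "{j. j \<in> I \<and> (j \<in> I \<and> occurs (\<W> j) {})} \<in> \<J>"
      by simp
    hence "measure_pmf.prob (Pi_pmf I False (\<lambda>j. return_pmf (occurs (\<W> j) {})))
        {f. {j\<in>I. f j} \<in> \<J>} = 1"
      using \<open>finite I\<close> by (subst Pi_pmf_return_pmf) (auto simp: indicator_def cong: conj_cong)
    thus ?thesis unfolding eq by simp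
  qed (simp add: random_subset_empty)
next
  case (insert e A)
  \<comment> \<open>\<open>\<sigma> j\<close> is the private copy of \<open>e\<close> given to index
    \<open>j\<close>. If it is present, \<open>e\<close> is free for \<open>j\<close> and is removed
    from its witnesses; the shared set no longer contains \<open>e\<close>.\<close>
  define \<W>' where "\<W>' = (\<lambda>\<sigma> j. if \<sigma> j then (\<lambda>W. W - {e}) ` \<W> j else \<W> j)"
  define a where "a = (\<lambda>x j. measure_pmf.prob (random_subset A p)
    {E. occurs (\<W> j) (if x then insert e E else E)})"
  let ?\<sigma> = "Pi_pmf I False (\<lambda>_. bernoulli_pmf p)"
  have occurs': "occurs (\<W>' \<sigma> j) E \<longleftrightarrow> occurs (\<W> j) (if \<sigma> j then insert e E else E)" for \<sigma> j E
    by (auto simp: \<W>'_def occurs_def)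
  have a_eq: "measure_pmf.prob (random_subset (insert e A) p) {E. occurs (\<W> j) E} =
      p * a True j + (1 - p) * a False j" for j
    unfolding random_subset_insert[OF insert.hyps(1,2)] a_def
    using assms(3,4) by (simp add: prob_bind_bernoulli vimage_def)
  \<comment> \<open>With the other coordinates fixed as \<open>E\<close>, one shared copy of
    \<open>e\<close> is compared with private copies. The critical case is that disjoint occurrence
    hinges on \<open>e\<close>, where the left side is \<open>p\<close>.\<close>
  have pointwise: "measure_pmf.prob (bernoulli_pmf p)
        {x. occur_disjointly \<J> \<W> (if x then insert e E else E)} \<le>
      measure_pmf.prob ?\<sigma> {\<sigma>. occur_disjointly \<J> (\<W>' \<sigma>) E}"
    if E: "E \<subseteq> A" for E
  proof -
    have e: "e \<notin> E" using E insert.hyps by auto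
    consider "occur_disjointly \<J> \<W> E"
      | "\<not> occur_disjointly \<J> \<W> E" "occur_disjointly \<J> \<W> (insert e E)"
      | "\<not> occur_disjointly \<J> \<W> E" "\<not> occur_disjointly \<J> \<W> (insert e E)"
      by blast
    thus ?thesis
    proof cases
      case 1
      then obtain J W where J: "J \<in> \<J>" "\<forall>j\<in>J. W j \<in> \<W> j \<and> W j \<subseteq> E" "disjoint_family_on W J"
        by (auto simp: occur_disjointly_def)
      have "occur_disjointly \<J> (\<W>' \<sigma>) E" for \<sigma>
      proof -
        have "W j \<in> \<W>' \<sigma> j" if "j \<in> J" for j
        proof -
          have "W j = W j - {e}" using J(2) that e by auto
          thus ?thesis using J(2) that by (auto simp: \<W>'_def)
        qed
        thus ?thesis using J unfolding occur_disjointly_def by blast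
      qed
      thus ?thesis by simp
    next
      case 2
      then obtain J W where J: "J \<in> \<J>" "\<forall>j\<in>J. W j \<in> \<W> j \<and> W j \<subseteq> insert e E"
          "disjoint_family_on W J"
        by (auto simp: occur_disjointly_def)
      \<comment> \<open>If no witness used \<open>e\<close>, disjoint occurrence would already hold
        in \<open>E\<close>. By disjointness only \<open>j\<close> uses \<open>e\<close>, so the
        copy of \<open>j\<close> alone suffices, an event of probability \<open>p\<close>.\<close>
      obtain j where j: "j \<in> J" "e \<in> W j"
        using J 2(1) by (fastforce simp: occur_disjointly_def)
      have "occur_disjointly \<J> (\<W>' \<sigma>) E" if "\<sigma> j" for \<sigma>
      proof -
        have "e \<notin> W i" if "i \<in> J" "i \<noteq> j" for i
          using J(3) that j by (auto simp: disjoint_family_on_def)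
        hence "W i - {e} \<in> \<W>' \<sigma> i" if "i \<in> J" for i
          using J(2) that \<open>\<sigma> j\<close> by (cases "i = j") (auto simp: \<W>'_def)
        moreover have "W i - {e} \<subseteq> E" if "i \<in> J" for i
          using J(2) that by auto
        moreover have "disjoint_family_on (\<lambda>i. W i - {e}) J"
          using J(3) by (auto simp: disjoint_family_on_def)
        ultimately show ?thesis
          using J(1) unfolding occur_disjointly_def by (intro bexI[of _ J] exI[of _ "\<lambda>i. W i - {e}"]) auto
      qed
      hence "measure_pmf.prob ?\<sigma> {\<sigma>. \<sigma> j} \<le>
          measure_pmf.prob ?\<sigma> {\<sigma>. occur_disjointly \<J> (\<W>' \<sigma>) E}"
        by (intro measure_pmf.finite_measure_mono) auto
      moreover have "measure_pmf.prob ?\<sigma> {\<sigma>. \<sigma> j} = p"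
        using J(1) j assms by (intro prob_Pi_bernoulli_component) auto
      moreover have "{x. occur_disjointly \<J> \<W> (if x then insert e E else E)} = {True}"
        using 2 by (auto split: if_splits)
      ultimately show ?thesis
        using assms(3,4) by (simp add: measure_pmf_single)
    next
      case 3
      hence "{x. occur_disjointly \<J> \<W> (if x then insert e E else E)} = {}"
        by (auto split: if_splits)
      thus ?thesis by simp
    qed
  qed
  have "measure_pmf.prob (random_subset (insert e A) p) {E. occur_disjointly \<J> \<W> E} =
      measure_pmf.prob (bind_pmf (random_subset A p) (\<lambda>E. map_pmf
        (\<lambda>x. if x then insert e E else E) (bernoulli_pmf p))) {E. occur_disjointly \<J> \<W> E}"
    unfolding random_subset_insert[OF insert.hyps(1,2)] map_pmf_def
    by (subst bind_commute_pmf) simp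
  also have "\<dots> \<le> measure_pmf.prob (bind_pmf (random_subset A p) (\<lambda>E. map_pmf
        (\<lambda>\<sigma>. occur_disjointly \<J> (\<W>' \<sigma>) E) ?\<sigma>)) {True}"
  proof (intro prob_bind_pmf_mono)
    fix E assume "E \<in> set_pmf (random_subset A p)"
    from pointwise[OF set_pmf_random_subset[OF this]]
    show "measure_pmf.prob (map_pmf (\<lambda>x. if x then insert e E else E) (bernoulli_pmf p))
          {E. occur_disjointly \<J> \<W> E} \<le>
        measure_pmf.prob (map_pmf (\<lambda>\<sigma>. occur_disjointly \<J> (\<W>' \<sigma>) E) ?\<sigma>) {True}"
      unfolding measure_map_pmf vimage_def by simp
  qed
  \<comment> \<open>Drawing the private copies first leaves, for each fixed \<open>\<sigma>\<close>,
    an instance of the induction hypothesis on \<open>A\<close>.\<close>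
  also have "\<dots> = measure_pmf.prob (bind_pmf ?\<sigma> (\<lambda>\<sigma>. map_pmf
        (\<lambda>E. occur_disjointly \<J> (\<W>' \<sigma>) E) (random_subset A p))) {True}"
    unfolding map_pmf_def by (subst bind_commute_pmf) simp
  also have "\<dots> \<le> measure_pmf.prob (bind_pmf ?\<sigma> (\<lambda>\<sigma>. Pi_pmf I False
        (\<lambda>j. bernoulli_pmf (a (\<sigma> j) j)))) {f. {j\<in>I. f j} \<in> \<J>}"
  proof (intro prob_bind_pmf_mono)
    fix \<sigma>
    show "measure_pmf.prob (map_pmf (\<lambda>E. occur_disjointly \<J> (\<W>' \<sigma>) E) (random_subset A p)) {True} \<le>
       measure_pmf.prob (Pi_pmf I False (\<lambda>j. bernoulli_pmf (a (\<sigma> j) j))) {f. {j\<in>I. f j} \<in> \<J>}"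
      using insert.IH[of "\<W>' \<sigma>"] by (simp add: vimage_def occurs' a_def)
  qed
  also have "bind_pmf ?\<sigma> (\<lambda>\<sigma>. Pi_pmf I False (\<lambda>j. bernoulli_pmf (a (\<sigma> j) j))) =
      Pi_pmf I False (\<lambda>j. bernoulli_pmf (p * a True j + (1 - p) * a False j))"
  proof -
    have "bind_pmf (bernoulli_pmf p) (\<lambda>x. bernoulli_pmf (a x j)) =
        bernoulli_pmf (p * a True j + (1 - p) * a False j)" for j
      using assms(3,4) by (intro bind_bernoulli_pmf_bernoulli) (auto simp: a_def)
    thus ?thesis
      using Pi_pmf_bind[OF \<open>finite I\<close>, of False "\<lambda>_. bernoulli_pmf p" "\<lambda>j x. bernoulli_pmf (a x j)" False]
      by simp
  qed
  finally show ?case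
    by (simp add: a_eq)
qed

text \<open>With \<open>\<J> = {J}\<close> every independent copy has to succeed, which has the
  product probability.\<close>

corollary van_den_Berg_Kesten:
  assumes "finite A" "finite J" "0 \<le> p" "p \<le> 1"
  shows "measure_pmf.prob (random_subset A p) {E. occur_disjointly {J} \<W> E} \<le>
    (\<Prod>j\<in>J. measure_pmf.prob (random_subset A p) {E. occurs (\<W> j) E})"
proof -
  have "{f. {j\<in>J. f j} \<in> {J}} = Pi J (\<lambda>_. {True})"
    by (auto simp: Pi_def)
  thus ?thesis
    using occur_disjointly_le_independent[OF assms(1,2,3,4), of "{J}" \<W>]
    by (simp add: measure_Pi_pmf_Pi[OF assms(2)] measure_pmf_single)
qed

text \<open>Thinning: keeping each success of a Bernoulli variable of parameter \<open>b\<close>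
  with probability \<open>a j / b\<close> gives parameter \<open>a j\<close>. The original sample
  dominates the thinned one, and \<open>S\<close> is closed upwards.\<close>

lemma prob_Pi_bernoulli_mono:
  assumes "finite I" "\<And>j. j \<in> I \<Longrightarrow> 0 \<le> a j" "\<And>j. j \<in> I \<Longrightarrow> a j \<le> b" "b \<le> 1"
    and up: "\<And>f g. f \<in> S \<Longrightarrow> (\<And>j. f j \<Longrightarrow> g j) \<Longrightarrow> g \<in> S"
  shows "measure_pmf.prob (Pi_pmf I False (\<lambda>j. bernoulli_pmf (a j))) S \<le>
    measure_pmf.prob (Pi_pmf I False (\<lambda>_. bernoulli_pmf b)) S"
proof (cases "I = {} \<or> b = 0")
  case True
  hence "bernoulli_pmf (a j) = bernoulli_pmf b" if "j \<in> I" for j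
    using assms(2)[OF that] assms(3)[OF that] that by auto
  hence "Pi_pmf I False (\<lambda>j. bernoulli_pmf (a j)) = Pi_pmf I False (\<lambda>_. bernoulli_pmf b)"
    by (intro Pi_pmf_cong) auto
  thus ?thesis by simp
next
  case False
  then obtain i where "i \<in> I" by auto
  hence b: "0 < b" using assms(2,3)[of i] False by auto
  have "bernoulli_pmf (a j) =
      bind_pmf (bernoulli_pmf b) (\<lambda>x. bernoulli_pmf (if x then a j / b else 0))" if "j \<in> I" for j
    using b assms(4) assms(2,3)[OF that] by (subst bind_bernoulli_pmf_bernoulli) (auto simp: field_simps)
  hence "Pi_pmf I False (\<lambda>j. bernoulli_pmf (a j)) = Pi_pmf I False
      (\<lambda>j. bind_pmf (bernoulli_pmf b) (\<lambda>x. bernoulli_pmf (if x then a j / b else 0)))"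
    by (intro Pi_pmf_cong) auto
  also have "\<dots> = bind_pmf (Pi_pmf I False (\<lambda>_. bernoulli_pmf b))
      (\<lambda>f. Pi_pmf I False (\<lambda>j. bernoulli_pmf (if f j then a j / b else 0)))"
    by (rule Pi_pmf_bind[OF assms(1)])
  also have "measure_pmf.prob \<dots> S \<le>
      measure_pmf.prob (bind_pmf (Pi_pmf I False (\<lambda>_. bernoulli_pmf b)) return_pmf) S"
  proof (rule prob_bind_pmf_mono)
    fix f
    show "measure_pmf.prob (Pi_pmf I False (\<lambda>j. bernoulli_pmf (if f j then a j / b else 0))) S \<le>
        measure_pmf.prob (return_pmf f) S"
    proof (cases "f \<in> S")
      case False
      have "g \<notin> S" if "g \<in> set_pmf (Pi_pmf I False (\<lambda>j. bernoulli_pmf (if f j then a j / b else 0)))" for g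
      proof
        assume "g \<in> S"
        have "f j" if "g j" for j
        proof (rule ccontr)
          assume "\<not> f j"
          have "g \<in> PiE_dflt I False (set_pmf \<circ> (\<lambda>j. bernoulli_pmf (if f j then a j / b else 0)))"
            using \<open>g \<in> set_pmf _\<close> by (simp add: set_Pi_pmf[OF assms(1)])
          hence "g j \<in> (if j \<in> I then set_pmf (bernoulli_pmf (if f j then a j / b else 0)) else {False})"
            by (simp add: PiE_dflt_def split: if_split_asm)
          thus False
            using \<open>\<not> f j\<close> \<open>g j\<close> by (simp add: bernoulli_pmf_0_1 split: if_split_asm)
        qed
        thus False using up[OF \<open>g \<in> S\<close>, of f] False by blast
      qed
      hence "measure_pmf.prob (Pi_pmf I False (\<lambda>j. bernoulli_pmf (if f j then a j / b else 0))) S = 0"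
        by (subst measure_pmf_zero_iff) auto
      thus ?thesis by simp
    qed simp
  qed
  finally show ?thesis by (simp add: bind_return_pmf')
qed

text \<open>The number of successes among the independent copies is dominated by a binomial
  variable. This drives the survival recursion, where \<open>k - 1\<close> of \<open>n\<close>
  possible children must succeed disjointly.\<close>

corollary occur_disjointly_card_le_binomial:
  assumes "finite A" "finite I" "0 \<le> p" "p \<le> 1" "b \<le> 1" "card I = n"
    and "\<And>j. j \<in> I \<Longrightarrow> measure_pmf.prob (random_subset A p) {E. occurs (\<W> j) E} \<le> b" "0 \<le> b"
  shows "measure_pmf.prob (random_subset A p) {E. occur_disjointly {J. J \<subseteq> I \<and> card J \<ge> m} \<W> E} \<le>
    measure_pmf.prob (binomial_pmf n b) {m..}"
proof -
  have "measure_pmf.prob (random_subset A p) {E. occur_disjointly {J. J \<subseteq> I \<and> card J \<ge> m} \<W> E} \<le>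
      measure_pmf.prob
      (Pi_pmf I False (\<lambda>j. bernoulli_pmf (measure_pmf.prob (random_subset A p) {E. occurs (\<W> j) E})))
      {f. {j\<in>I. f j} \<in> {J. J \<subseteq> I \<and> card J \<ge> m}}"
  proof (rule occur_disjointly_le_independent)
    fix J J'
    assume "J \<in> {J. J \<subseteq> I \<and> card J \<ge> m}" "J \<subseteq> J'" "J' \<subseteq> I"
    moreover from this have "card J \<le> card J'"
      using assms(2) by (intro card_mono) (auto intro: finite_subset)
    ultimately show "J' \<in> {J. J \<subseteq> I \<and> card J \<ge> m}"
      by auto
  qed (use assms in auto)
  also have "\<dots> \<le> measure_pmf.prob (Pi_pmf I False (\<lambda>_. bernoulli_pmf b))
      {f. {j\<in>I. f j} \<in> {J. J \<subseteq> I \<and> card J \<ge> m}}"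
  proof (rule prob_Pi_bernoulli_mono)
    fix f g :: "_ \<Rightarrow> bool"
    assume f: "f \<in> {f. {j\<in>I. f j} \<in> {J. J \<subseteq> I \<and> card J \<ge> m}}" and fg: "\<And>j. f j \<Longrightarrow> g j"
    have "card {j\<in>I. f j} \<le> card {j\<in>I. g j}"
      using assms(2) fg by (intro card_mono) auto
    thus "g \<in> {f. {j\<in>I. f j} \<in> {J. J \<subseteq> I \<and> card J \<ge> m}}"
      using f by auto
  qed (use assms in auto)
  also have "{f. {j\<in>I. f j} \<in> {J. J \<subseteq> I \<and> card J \<ge> m}} = (\<lambda>f. card {j\<in>I. f j}) -` {m..}"
    by auto
  also have "measure_pmf.prob (Pi_pmf I False (\<lambda>_. bernoulli_pmf b)) \<dots> =
      measure_pmf.prob (binomial_pmf n b) {m..}"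
    using assms by (subst binomial_pmf_altdef'[of I n b False]) auto
  finally show ?thesis .
qed

section \<open>Tree witnesses and their attachment to a tree\<close>

text \<open>Excluding \<open>{v, w}\<close> from \<open>W\<close> makes the edge and the witness
  below it disjoint, so the edge contributes a separate factor.\<close>

definition pendant :: "'a \<Rightarrow> 'a \<Rightarrow> 'a set set set \<Rightarrow> 'a set set set" where
  "pendant v w \<W> = {insert {v, w} W | W. W \<in> \<W> \<and> {v, w} \<notin> W}"

text \<open>Branches are disjoint only as edge sets and may share vertices; disjoint occurrence asks
  for no more.\<close>

primrec tree_wit :: "nat \<Rightarrow> 'a set \<Rightarrow> nat \<Rightarrow> 'a \<Rightarrow> 'a set set set" where
  "tree_wit k V 0 = (\<lambda>v. {{}})"
| "tree_wit k V (Suc t) = (\<lambda>v. {\<Union>(f ` N) | f N. N \<subseteq> V \<and> card N = k - 1 \<and>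
     (\<forall>w\<in>N. f w \<in> pendant v w (tree_wit k V t w)) \<and> disjoint_family_on f N})"

primrec tree_size :: "nat \<Rightarrow> nat \<Rightarrow> nat" where
  "tree_size k 0 = 1"
| "tree_size k (Suc t) = 1 + (k - 1) * tree_size k t"

definition induced :: "'a set set \<Rightarrow> 'a set \<Rightarrow> 'a set set" where
  "induced E X = {e \<in> E. e \<subseteq> X}"

text \<open>No nonempty proper subset of \<open>X\<close> is closed under adjacency within
  \<open>X\<close>. This form suits both adding a vertex and exploring from a root.\<close>

definition connected_in :: "'a set set \<Rightarrow> 'a set \<Rightarrow> bool" where
  "connected_in E X \<longleftrightarrow>
     (\<forall>Y\<subseteq>X. Y \<noteq> {} \<longrightarrow> (\<forall>a\<in>Y. \<forall>b\<in>X. {a, b} \<in> E \<longrightarrow> b \<in> Y) \<longrightarrow> Y = X)"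

lemma connected_in_insert:
  assumes "connected_in E X" "y \<in> X" "x \<notin> X" "{x, y} \<in> E"
  shows "connected_in E (insert x X)"
  unfolding connected_in_def
proof (intro allI impI)
  fix Y assume Y: "Y \<subseteq> insert x X" "Y \<noteq> {}" "\<forall>a\<in>Y. \<forall>b\<in>insert x X. {a, b} \<in> E \<longrightarrow> b \<in> Y"
  have "y \<in> Y" if "x \<in> Y" using Y(3) that assms by blast
  hence "Y \<inter> X \<noteq> {}" using Y(1,2) assms(2) by blast
  moreover have "\<forall>a\<in>Y \<inter> X. \<forall>b\<in>X. {a, b} \<in> E \<longrightarrow> b \<in> Y \<inter> X" using Y(3) by blast
  ultimately have "Y \<inter> X = X" using assms(1) unfolding connected_in_def by (metis inf.cobounded2)
  hence "X \<subseteq> Y" by blast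
  moreover have "x \<in> Y" using Y(3) \<open>X \<subseteq> Y\<close> assms(2,4) by (auto simp: insert_commute)
  ultimately show "Y = insert x X" using Y(1) by blast
qed

text \<open>Abstracts from peeling the one property that growth needs of \<open>S\<close>. Later
  \<open>S i\<close> is the set of endpoints of edges left after \<open>i\<close> rounds.\<close>

locale survivors =
  fixes k :: nat and V :: "'a set" and E :: "'a set set" and S :: "nat \<Rightarrow> 'a set"
  assumes finite_V: "finite V" and E_subset: "E \<subseteq> all_edges V" and k_ge_3: "k \<ge> 3"
    and survivor_degree: "v \<in> S (Suc i) \<Longrightarrow> k \<le> card {w \<in> S i. {v, w} \<in> E}"
begin

definition new_edges :: "'a set \<Rightarrow> 'a set \<Rightarrow> 'a set set" where
  "new_edges X U = induced E (X \<union> U) - induced E X"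

section \<open>Edges gained when a vertex set grows\<close>

lemma finite_E [simp]: "finite E"
proof (rule finite_subset)
  show "E \<subseteq> Pow V" using E_subset by (auto simp: all_edges_def)
qed (simp add: finite_V)

lemma edgeD: "{v, w} \<in> E \<Longrightarrow> v \<in> V \<and> w \<in> V \<and> v \<noteq> w"
  using E_subset by (auto simp: all_edges_def)

lemma edge_other: "e \<in> E \<Longrightarrow> v \<in> e \<Longrightarrow> \<exists>w. w \<noteq> v \<and> e = {v, w}"
  using E_subset by (auto simp: all_edges_def card_2_iff)

lemma finite_induced [simp]: "finite (induced E X)"
  by (simp add: induced_def)

lemma finite_new_edges [simp]: "finite (new_edges X U)"
  by (simp add: new_edges_def)

lemma new_edges_Un: "new_edges X (U \<union> U') = new_edges X U \<union> new_edges (X \<union> U) U'"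
  by (auto simp: new_edges_def induced_def)

lemma new_edges_Un_disjoint: "new_edges X U \<inter> new_edges (X \<union> U) U' = {}"
  by (auto simp: new_edges_def induced_def)

lemma card_new_edges_Un:
  "card (new_edges X (U \<union> U')) = card (new_edges X U) + card (new_edges (X \<union> U) U')"
  unfolding new_edges_Un by (intro card_Un_disjoint) (auto simp: new_edges_Un_disjoint)

lemma card_induced_Un: "card (induced E (X \<union> U)) = card (induced E X) + card (new_edges X U)"
proof -
  have "induced E (X \<union> U) = induced E X \<union> new_edges X U"
    by (auto simp: new_edges_def induced_def)
  moreover have "induced E X \<inter> new_edges X U = {}"
    by (auto simp: new_edges_def)
  ultimately show ?thesis
    by (simp add: card_Un_disjoint)
qed

lemma mem_new_edges: "{x, y} \<in> E \<Longrightarrow> x \<in> U \<Longrightarrow> U \<inter> X = {} \<Longrightarrow> y \<in> X \<union> U \<Longrightarrow> {x, y} \<in> new_edges X U"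
  by (auto simp: new_edges_def induced_def)

text \<open>
  The two outcomes of growing a witness at \<open>x\<close>, entered from \<open>y \<in> X\<close>, by adding one vertex at a
  time. Either every new vertex has a single neighbour among the earlier ones, and the new edges form
  a tree; or growth stops at the first vertex with \<open>d \<ge> 2\<close> earlier neighbours. In the second case
  there are \<open>d - 1\<close> more new edges than new vertices, and at most \<open>d \<le> 2 (d - 1)\<close> of the new edges
  reach back to \<open>X\<close>.
\<close>

definition grown :: "nat \<Rightarrow> 'a set \<Rightarrow> 'a \<Rightarrow> 'a \<Rightarrow> 'a set \<Rightarrow> bool" where
  "grown i X x y U \<longleftrightarrow> x \<in> U \<and> U \<subseteq> V \<and> U \<inter> X = {} \<and> card U \<le> tree_size k i \<and>
     connected_in E (X \<union> U) \<and> card U \<le> card (new_edges X U) \<and>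
     ((card U < card (new_edges X U) \<and>
         card {e \<in> new_edges X U. e \<inter> X \<noteq> {}} \<le> 2 * (card (new_edges X U) - card U)) \<or>
      (\<exists>W\<in>tree_wit k V i x. {x, y} \<notin> W \<and> new_edges X U = insert {x, y} W \<and> (\<forall>e\<in>W. e \<inter> X = {})))"

text \<open>A second edge from \<open>x\<close> back to \<open>X\<close> stops growth at
  \<open>{x}\<close>: there are \<open>d \<ge> 2\<close> new edges for one new vertex, and
  \<open>d \<le> 2 * (d - 1)\<close>.\<close>

lemma grow_single:
  assumes "x \<notin> X" "y \<in> X" "{x, y} \<in> E" "connected_in E X" "new_edges X {x} \<noteq> {{x, y}}"
  shows "grown i X x y {x}"
proof -
  let ?D = "new_edges X {x}"
  have "{x, y} \<in> ?D" using assms by (intro mem_new_edges) auto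
  hence "{{x, y}} \<subset> ?D" using assms(5) by blast
  hence "card {{x, y}} < card ?D" by (intro psubset_card_mono) auto
  hence 2: "card ?D \<ge> 2" by simp
  have "card {e \<in> ?D. e \<inter> X \<noteq> {}} \<le> card ?D" by (intro card_mono) auto
  hence "card {e \<in> ?D. e \<inter> X \<noteq> {}} \<le> 2 * (card ?D - 1)" using 2 by simp
  moreover have "tree_size k i \<ge> 1" by (cases i) auto
  ultimately show ?thesis
    using assms 2 edgeD[OF assms(3)] connected_in_insert[OF assms(4,2,1,3)]
    unfolding grown_def by auto
qed

text \<open>Induction on the depth. After \<open>x\<close> is entered from \<open>y\<close>,
  \<open>k - 1\<close> of its other surviving neighbours are grown one after another, each relative
  to all vertices found before; the first collision ends the process.\<close>

lemma grow:
  assumes "X \<subseteq> V" "x \<notin> X" "y \<in> X" "{x, y} \<in> E" "x \<in> S i" "connected_in E X"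
  shows "\<exists>U. grown i X x y U"
  using assms
proof (induction i arbitrary: X x y)
  case 0
  show ?case
  proof (cases "new_edges X {x} = {{x, y}}")
    case True
    hence "grown 0 X x y {x}"
      using 0 connected_in_insert[OF 0(6,3,2,4)] edgeD[OF 0(4)] by (auto simp: grown_def)
    thus ?thesis by blast
  qed (use grow_single 0 in blast)
next
  case (Suc i)
  show ?case
  proof (cases "new_edges X {x} = {{x, y}}")
    case False
    thus ?thesis using grow_single Suc.prems by blast
  next
    case single: True
    let ?X = "insert x X"
    have xV: "x \<in> V" using edgeD[OF Suc.prems(4)] by blast
    define M where "M = {w \<in> S i. {x, w} \<in> E}"
    have "M \<subseteq> V" using edgeD by (auto simp: M_def)
    hence "finite M" using finite_V finite_subset by blast
    hence "k - 1 \<le> card (M - {y})"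
      using survivor_degree[OF Suc.prems(5)] by (auto simp: M_def card_Diff_singleton_if)
    then obtain N where N: "N \<subseteq> M - {y}" "card N = k - 1" "finite N"
      by (rule obtain_subset_with_card_n)
    have N_new: "w \<notin> ?X" if "w \<in> N" for w
    proof
      assume "w \<in> ?X"
      have w: "{x, w} \<in> E" "w \<noteq> y" using that N(1) by (auto simp: M_def)
      hence "w \<in> X" using edgeD \<open>w \<in> ?X\<close> by blast
      hence "{x, w} \<in> new_edges X {x}" using w Suc.prems(2) by (intro mem_new_edges) auto
      thus False using single w(2) by (auto simp: doubleton_eq_iff)
    qed
    have conn: "connected_in E ?X"
      using connected_in_insert[OF Suc.prems(6,3,2,4)] .
    \<comment> \<open>Invariant for the children treated so far. After a collision the inequality is
      strict, which leaves room for the edge \<open>{x, y}\<close> added at the end; before one,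
      branches avoid \<open>X\<close> and touch \<open>x\<close> only in their first edge.\<close>
    have "\<exists>U. U \<subseteq> V \<and> U \<inter> ?X = {} \<and> card U \<le> card N' * tree_size k i \<and>
        connected_in E (?X \<union> U) \<and> card U \<le> card (new_edges ?X U) \<and>
        ((card U < card (new_edges ?X U) \<and>
           card {e \<in> new_edges ?X U. e \<inter> X \<noteq> {}} < 2 * (card (new_edges ?X U) - card U)) \<or>
         (\<exists>f. (\<forall>w\<in>N'. f w \<in> pendant x w (tree_wit k V i w)) \<and> disjoint_family_on f N' \<and>
           new_edges ?X U = \<Union>(f ` N') \<and>
           (\<forall>w\<in>N'. \<forall>e\<in>f w. e \<inter> X = {} \<and> (x \<in> e \<longrightarrow> e = {x, w}))))"
      if "N' \<subseteq> N" for N'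
      using finite_subset[OF that N(3)] that
    proof (induction N' rule: finite_induct)
      case empty
      show ?case
        using conn by (intro exI[of _ "{}"]) (simp add: new_edges_def disjoint_family_on_def)
    next
      case (insert w N')
      have "N' \<subseteq> N" using insert.prems by simp
      from insert.IH[OF this] obtain U where U: "U \<subseteq> V" "U \<inter> ?X = {}" "card U \<le> card N' * tree_size k i"
          "connected_in E (?X \<union> U)" "card U \<le> card (new_edges ?X U)"
        and cases: "(card U < card (new_edges ?X U) \<and>
             card {e \<in> new_edges ?X U. e \<inter> X \<noteq> {}} < 2 * (card (new_edges ?X U) - card U)) \<or>
           (\<exists>f. (\<forall>w\<in>N'. f w \<in> pendant x w (tree_wit k V i w)) \<and> disjoint_family_on f N' \<and>
             new_edges ?X U = \<Union>(f ` N') \<and>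
             (\<forall>w\<in>N'. \<forall>e\<in>f w. e \<inter> X = {} \<and> (x \<in> e \<longrightarrow> e = {x, w})))"
        by (elim exE conjE) (rule that)
      have card_insert: "card (insert w N') * tree_size k i = tree_size k i + card N' * tree_size k i"
        using insert.hyps by simp
      from cases show ?case
      proof (elim disjE exE conjE)
        assume "card U < card (new_edges ?X U)"
          "card {e \<in> new_edges ?X U. e \<inter> X \<noteq> {}} < 2 * (card (new_edges ?X U) - card U)"
        thus ?thesis using U by (intro exI[of _ U] conjI disjI1) (simp_all add: card_insert)
      next
        fix f
        assume f: "\<forall>w\<in>N'. f w \<in> pendant x w (tree_wit k V i w)"
          "disjoint_family_on f N'" "new_edges ?X U = \<Union>(f ` N')"
          "\<forall>w\<in>N'. \<forall>e\<in>f w. e \<inter> X = {} \<and> (x \<in> e \<longrightarrow> e = {x, w})"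
        have w: "w \<in> N" "{x, w} \<in> E" "w \<in> S i" "w \<noteq> y" "w \<notin> ?X"
          using insert.prems N(1) N_new by (auto simp: M_def)
        \<comment> \<open>Otherwise the edge from \<open>x\<close> to \<open>w\<close> would lie in
          an earlier branch, whose only edge at \<open>x\<close> leads to a different child.\<close>
        have "w \<notin> U"
        proof
          assume "w \<in> U"
          hence "{w, x} \<in> new_edges ?X U"
            using w(2) U(2) by (intro mem_new_edges) (auto simp: insert_commute)
          then obtain w' where "w' \<in> N'" "{w, x} \<in> f w'" unfolding f(3) by (elim UN_E)
          hence "{w, x} = {x, w'}" using f(4) by simp
          thus False using \<open>w' \<in> N'\<close> insert.hyps(2) by (auto simp: doubleton_eq_iff)
        qed
        then obtain U' where "grown i (?X \<union> U) w x U'"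
          using insert.hyps w U Suc.prems(1) xV Suc.IH[of "?X \<union> U" w x]
          by (auto simp: insert_commute)
        note U' = this[unfolded grown_def]
        let ?D = "new_edges ?X U" and ?D' = "new_edges (?X \<union> U) U'"
        have D: "new_edges ?X (U \<union> U') = ?D \<union> ?D'" "?D \<inter> ?D' = {}"
          by (rule new_edges_Un, rule new_edges_Un_disjoint)
        have cardD: "card (new_edges ?X (U \<union> U')) = card ?D + card ?D'"
          by (rule card_new_edges_Un)
        have cardU: "card (U \<union> U') = card U + card U'"
          using U U' finite_V by (intro card_Un_disjoint) (auto intro: finite_subset)
        have common: "U \<union> U' \<subseteq> V \<and> (U \<union> U') \<inter> ?X = {} \<and>
            card (U \<union> U') \<le> card (insert w N') * tree_size k i \<and>
            connected_in E (?X \<union> (U \<union> U')) \<and> card (U \<union> U') \<le> card (new_edges ?X (U \<union> U'))"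
          unfolding card_insert cardD cardU using U U' by (auto simp: Un_assoc)
        from U' consider "card U' < card ?D'"
            "card {e \<in> ?D'. e \<inter> (?X \<union> U) \<noteq> {}} \<le> 2 * (card ?D' - card U')"
          | W where "W \<in> tree_wit k V i w" "{w, x} \<notin> W" "?D' = insert {w, x} W"
            "\<forall>e\<in>W. e \<inter> (?X \<union> U) = {}"
          by blast
        thus ?thesis
        proof cases
          case 1
          \<comment> \<open>Earlier branches avoid \<open>X\<close>, and \<open>{w, x}\<close>
            reaches back to \<open>x\<close> but not to \<open>X\<close>; this one edge makes the
            inequality strict.\<close>
          have "e \<inter> X = {}" if "e \<in> ?D" for e
            using that f(4) unfolding f(3) by (elim UN_E) simp
          hence "{e \<in> ?D \<union> ?D'. e \<inter> X \<noteq> {}} \<subseteq> {e \<in> ?D'. e \<inter> (?X \<union> U) \<noteq> {}}"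
            by auto
          moreover have "{w, x} \<in> {e \<in> ?D'. e \<inter> (?X \<union> U) \<noteq> {}}"
          proof -
            have "{w, x} \<in> ?D'" using U' w(2) by (intro mem_new_edges) (auto simp: insert_commute)
            thus ?thesis by auto
          qed
          moreover have "{w, x} \<notin> {e \<in> ?D \<union> ?D'. e \<inter> X \<noteq> {}}"
            using w(5) Suc.prems(2) by auto
          ultimately have "{e \<in> ?D \<union> ?D'. e \<inter> X \<noteq> {}} \<subset> {e \<in> ?D'. e \<inter> (?X \<union> U) \<noteq> {}}"
            by blast
          hence "card {e \<in> ?D \<union> ?D'. e \<inter> X \<noteq> {}} < card {e \<in> ?D'. e \<inter> (?X \<union> U) \<noteq> {}}"
            by (intro psubset_card_mono) auto
          hence "card (U \<union> U') < card (new_edges ?X (U \<union> U')) \<and>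
              card {e \<in> new_edges ?X (U \<union> U'). e \<inter> X \<noteq> {}} <
                2 * (card (new_edges ?X (U \<union> U')) - card (U \<union> U'))"
            using 1 U(5) cardD unfolding D(1) cardU by (intro conjI) linarith+
          thus ?thesis using common by blast
        next
          case (2 W)
          define g where "g = f(w := insert {x, w} W)"
          have g: "g w = ?D'" "\<And>w'. w' \<in> N' \<Longrightarrow> g w' = f w'"
            using 2(3) insert.hyps(2) by (auto simp: g_def insert_commute)
          have "\<forall>w'\<in>insert w N'. g w' \<in> pendant x w' (tree_wit k V i w')"
            using f(1) 2(1,2) by (auto simp: g_def pendant_def insert_commute)
          moreover have "disjoint_family_on g (insert w N')"
          proof -
            have "g w \<inter> g w' = {}" if "w' \<in> N'" for w'
              using D(2) f(3) g that by blast
            moreover have "disjoint_family_on g N'"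
              using f(2) g(2) by (simp add: disjoint_family_on_def)
            ultimately show ?thesis
              using insert.hyps(2) by (auto simp: disjoint_family_on_insert)
          qed
          moreover have "new_edges ?X (U \<union> U') = \<Union>(g ` insert w N')"
            unfolding D(1) using f(3) g by auto
          moreover have "\<forall>w'\<in>insert w N'. \<forall>e\<in>g w'. e \<inter> X = {} \<and> (x \<in> e \<longrightarrow> e = {x, w'})"
          proof -
            have "e \<inter> X = {} \<and> (x \<in> e \<longrightarrow> e = {x, w})" if "e \<in> g w" for e
              using that 2(4) w(5) Suc.prems(2) by (auto simp: g_def)
            thus ?thesis using f(4) g(2) by auto
          qed
          ultimately show ?thesis using common by blast
        qed
      qed
    qed
    from this[OF order.refl] obtain U where U: "U \<subseteq> V" "U \<inter> ?X = {}"
        "card U \<le> card N * tree_size k i" "connected_in E (?X \<union> U)"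
        "card U \<le> card (new_edges ?X U)"
      and cases: "(card U < card (new_edges ?X U) \<and>
           card {e \<in> new_edges ?X U. e \<inter> X \<noteq> {}} < 2 * (card (new_edges ?X U) - card U)) \<or>
         (\<exists>f. (\<forall>w\<in>N. f w \<in> pendant x w (tree_wit k V i w)) \<and> disjoint_family_on f N \<and>
           new_edges ?X U = \<Union>(f ` N) \<and>
           (\<forall>w\<in>N. \<forall>e\<in>f w. e \<inter> X = {} \<and> (x \<in> e \<longrightarrow> e = {x, w})))"
      by (elim exE conjE) (rule that)
    let ?D = "new_edges ?X U" and ?U = "insert x U"
    have D: "new_edges X ?U = insert {x, y} ?D" "{x, y} \<notin> ?D"
      using new_edges_Un[of X "{x}" U] new_edges_Un_disjoint[of X "{x}" U] single by auto
    hence cardD: "card (new_edges X ?U) = Suc (card ?D)" by simp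
    have cardU: "card ?U = Suc (card U)"
      using U(1,2) finite_V by (subst card_insert_disjoint) (auto intro: finite_subset)
    have common: "x \<in> ?U \<and> ?U \<subseteq> V \<and> ?U \<inter> X = {} \<and> card ?U \<le> tree_size k (Suc i) \<and>
        connected_in E (X \<union> ?U) \<and> card ?U \<le> card (new_edges X ?U)"
      unfolding cardU cardD using U xV Suc.prems(2) N(2) by auto
    from cases show ?thesis
    proof (elim disjE exE conjE)
      assume B: "card U < card ?D" "card {e \<in> ?D. e \<inter> X \<noteq> {}} < 2 * (card ?D - card U)"
      have "{e \<in> new_edges X ?U. e \<inter> X \<noteq> {}} \<subseteq> insert {x, y} {e \<in> ?D. e \<inter> X \<noteq> {}}"
        unfolding D by auto
      hence "card {e \<in> new_edges X ?U. e \<inter> X \<noteq> {}} \<le> card (insert {x, y} {e \<in> ?D. e \<inter> X \<noteq> {}})"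
        by (intro card_mono) auto
      also have "\<dots> \<le> Suc (card {e \<in> ?D. e \<inter> X \<noteq> {}})" by (rule card_insert_le_m1) auto
      finally have "card {e \<in> new_edges X ?U. e \<inter> X \<noteq> {}} \<le> 2 * (card (new_edges X ?U) - card ?U)"
        using B unfolding cardD cardU by linarith
      moreover have "card ?U < card (new_edges X ?U)" using B unfolding cardD cardU by linarith
      ultimately have "grown (Suc i) X x y ?U"
        unfolding grown_def using common by (intro conjI disjI1) (elim conjE, assumption)+
      thus ?thesis ..
    next
      fix f
      assume f: "\<forall>w\<in>N. f w \<in> pendant x w (tree_wit k V i w)" "disjoint_family_on f N"
        "?D = \<Union>(f ` N)" "\<forall>w\<in>N. \<forall>e\<in>f w. e \<inter> X = {} \<and> (x \<in> e \<longrightarrow> e = {x, w})"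
      have "N \<subseteq> V" using N(1) \<open>M \<subseteq> V\<close> by blast
      hence "?D \<in> tree_wit k V (Suc i) x" using f N(2) by auto
      moreover have "\<forall>e\<in>?D. e \<inter> X = {}" using f(4) unfolding f(3) by simp
      ultimately have "grown (Suc i) X x y ?U"
        unfolding grown_def using common D by (intro conjI disjI2 bexI[of _ ?D]) (elim conjE, assumption)+
      thus ?thesis ..
    qed
  qed
qed

text \<open>
  A vertex of \<open>I\<close> is lost only if it meets an edge outside \<open>F\<close> and outside the witnesses found so
  far, and the number of such vertices is at most twice the excess
  \<open>card (induced E X) - card X + 1\<close>.
\<close>

lemma attach_witnesses:
  assumes "T \<subseteq> V" "connected_in E T" "F \<subseteq> induced E T" "card T \<le> card F + 1"
    and "I \<subseteq> T" "I \<subseteq> S (Suc t)" "\<And>v. v \<in> I \<Longrightarrow> card {e \<in> F. v \<in> e} \<le> 2"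
  obtains X J g where "T \<subseteq> X" "X \<subseteq> V" "card X \<le> card T + card I * tree_size k t" "connected_in E X"
    "J \<subseteq> I" "\<And>j. j \<in> J \<Longrightarrow> \<exists>w\<in>V. g j \<in> pendant j w (tree_wit k V t w)"
    "disjoint_family_on g J" "\<And>j. j \<in> J \<Longrightarrow> g j \<subseteq> E - F"
    "card I + 2 * card X \<le> card J + 2 * card (induced E X) + 2"
proof -
  \<comment> \<open>A loose edge lies inside \<open>X\<close> but neither in \<open>F\<close> nor in
    a chosen witness. Vertices of \<open>I\<close> on loose edges are the ones that may be left
    without a witness; their number is charged to the excess of \<open>X\<close>.\<close>
  define loose where "loose = (\<lambda>X (J :: 'a set) g. induced E X - F - \<Union>(g ` J))"
  define spoilt where "spoilt = (\<lambda>X J g. {v \<in> I. \<exists>e \<in> loose X J g. v \<in> e})"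
  have fin: "finite X" if "X \<subseteq> V" for X using that finite_V finite_subset by blast
  have fI: "finite I" using assms fin by blast
  have fin_spoilt: "finite (spoilt X J g)" for X J g using fI by (simp add: spoilt_def)
  have "\<exists>X J g. T \<subseteq> X \<and> X \<subseteq> V \<and> card X \<le> card T + card I' * tree_size k t \<and> connected_in E X \<and>
      J \<subseteq> I' \<and> (\<forall>j\<in>J. \<exists>w\<in>V. g j \<in> pendant j w (tree_wit k V t w)) \<and> disjoint_family_on g J \<and>
      (\<forall>j\<in>J. g j \<subseteq> induced E X - F \<and> (\<forall>e\<in>g j. e \<inter> T \<subseteq> {j})) \<and>
      card (spoilt X J g) + 2 * card X \<le> 2 * card (induced E X) + 2 \<and> I' \<subseteq> J \<union> spoilt X J g"
    if "I' \<subseteq> I" for I'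
    using finite_subset[OF that fI] that
  proof (induction I' rule: finite_induct)
    case empty
    \<comment> \<open>Initially the loose edges are those inside \<open>T\<close> but outside
      \<open>F\<close>, and each spoils at most two vertices. As \<open>J\<close> is empty,
      \<open>undefined\<close> can stand for \<open>g\<close>.\<close>
    have "spoilt T {} undefined \<subseteq> \<Union>(induced E T - F)"
      by (auto simp: spoilt_def loose_def)
    hence "card (spoilt T {} undefined) \<le> card (\<Union>(induced E T - F))"
      using E_subset finite_V
      by (intro card_mono finite_subset[of "\<Union>(induced E T - F)" V]) (auto simp: induced_def all_edges_def)
    also have "\<dots> \<le> (\<Sum>e\<in>induced E T - F. card e)"
      by (rule card_Union_le_sum_card)
    also have "\<dots> = (\<Sum>e\<in>induced E T - F. 2)"
      using E_subset by (intro sum.cong) (auto simp: induced_def all_edges_def)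
    also have "\<dots> = 2 * (card (induced E T) - card F)"
      using assms(3) by (simp add: card_Diff_subset finite_subset[OF assms(3)])
    finally have "card (spoilt T {} undefined) \<le> 2 * (card (induced E T) - card F)" .
    moreover have "card F \<le> card (induced E T)" using assms(3) by (intro card_mono) auto
    ultimately have "card (spoilt T {} undefined) + 2 * card T \<le> 2 * card (induced E T) + 2"
      using assms(4) by linarith
    thus ?case
      using assms(1,2) by (intro exI[of _ T] exI[of _ "{}"] exI[of _ undefined]) (simp add: disjoint_family_on_def)
  next
    case (insert v I')
    have "I' \<subseteq> I" using insert.prems by simp
    from insert.IH[OF this] obtain X J g where X: "T \<subseteq> X" "X \<subseteq> V" "card X \<le> card T + card I' * tree_size k t"
        "connected_in E X" "J \<subseteq> I'"
        "\<forall>j\<in>J. \<exists>w\<in>V. g j \<in> pendant j w (tree_wit k V t w)" "disjoint_family_on g J"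
        "\<forall>j\<in>J. g j \<subseteq> induced E X - F \<and> (\<forall>e\<in>g j. e \<inter> T \<subseteq> {j})"
        "card (spoilt X J g) + 2 * card X \<le> 2 * card (induced E X) + 2" "I' \<subseteq> J \<union> spoilt X J g"
      by (elim exE conjE) (rule that)
    have v: "v \<in> I" "v \<in> T" "v \<in> S (Suc t)" "v \<notin> J" using insert X(5) assms(5,6) by auto
    show ?case
    proof (cases "v \<in> spoilt X J g")
      case True
      thus ?thesis using X insert.hyps
        by (intro exI[of _ X] exI[of _ J] exI[of _ g]) (auto simp: algebra_simps)
    next
      case False
      \<comment> \<open>As \<open>v\<close> is not spoilt, an edge at \<open>v\<close> outside
        \<open>F\<close> would belong to the witness of some \<open>j \<in> J\<close>; but that
        witness meets \<open>T\<close> at most in \<open>j\<close>.\<close>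
      have edges_v: "e \<in> F" if e: "e \<in> induced E X" "v \<in> e" for e
      proof (rule ccontr)
        assume "e \<notin> F"
        then obtain j where "j \<in> J" "e \<in> g j"
          using False v(1) e by (auto simp: spoilt_def loose_def)
        thus False using X(8) v(2,4) e(2) by blast
      qed
      \<comment> \<open>Neighbours of \<open>v\<close> inside \<open>X\<close> are reached by edges
        of \<open>F\<close>, at most two in number, while at least \<open>k \<ge> 3\<close>
        neighbours survive.\<close>
      have "\<exists>w \<in> S t. {v, w} \<in> E \<and> w \<notin> X"
      proof (rule ccontr)
        assume *: "\<not> ?thesis"
        have "(\<lambda>w. {v, w}) ` {w \<in> S t. {v, w} \<in> E} \<subseteq> {e \<in> F. v \<in> e}"
          using * edges_v X(1) v(2) by (auto simp: induced_def)
        moreover have "finite F" using assms(3) by (rule finite_subset) simp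
        ultimately have "card ((\<lambda>w. {v, w}) ` {w \<in> S t. {v, w} \<in> E}) \<le> card {e \<in> F. v \<in> e}"
          by (intro card_mono) auto
        moreover have "inj_on (\<lambda>w. {v, w}) {w \<in> S t. {v, w} \<in> E}"
          by (auto simp: inj_on_def doubleton_eq_iff)
        ultimately show False
          using survivor_degree[OF v(3)] assms(7)[OF v(1)] k_ge_3 by (simp add: card_image)
      qed
      then obtain w where w: "w \<in> S t" "{v, w} \<in> E" "w \<notin> X" by blast
      obtain U where "grown t X w v U"
        using grow[of X w v t] w X v by (auto simp: insert_commute)
      note U = this[unfolded grown_def]
      let ?X = "X \<union> U" and ?D = "new_edges X U"
      have cardU: "card ?X = card X + card U"
        using U X(2) fin by (intro card_Un_disjoint) auto
      have cardE: "card (induced E ?X) = card (induced E X) + card ?D"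
        by (rule card_induced_Un)
      have D: "induced E ?X = induced E X \<union> ?D" "?D \<inter> induced E X = {}" "?D \<inter> F = {}"
        using assms(3) X(1) by (auto simp: new_edges_def induced_def)
      have gJ: "\<Union>(g ` J) \<subseteq> induced E X" using X(8) by blast
      have wvD: "{w, v} \<in> ?D"
        using U w v X(1) by (intro mem_new_edges) (auto simp: insert_commute)
      have card_insert: "card (insert v I') * tree_size k t = tree_size k t + card I' * tree_size k t"
        using insert.hyps by simp
      have common: "T \<subseteq> ?X \<and> ?X \<subseteq> V \<and> card ?X \<le> card T + card (insert v I') * tree_size k t \<and>
          connected_in E ?X"
        unfolding cardU card_insert using U X by auto
      from U consider "card U < card ?D"
          "card {e \<in> ?D. e \<inter> X \<noteq> {}} \<le> 2 * (card ?D - card U)"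
        | W where "W \<in> tree_wit k V t w" "{w, v} \<notin> W" "?D = insert {w, v} W" "\<forall>e\<in>W. e \<inter> X = {}"
        by blast
      thus ?thesis
      proof cases
        case 1
        \<comment> \<open>After a collision all new edges are loose. Each has at most one end in
          \<open>X\<close>, so at most \<open>2 * (card ?D - card U)\<close> vertices of
          \<open>I\<close> meet one, \<open>v\<close> among them. Twice the excess grows by the same
          amount.\<close>
        have loose: "loose ?X J g = loose X J g \<union> ?D"
          using gJ D(2,3) unfolding loose_def D(1) by blast
        define Sp where "Sp = {u \<in> I. \<exists>e\<in>?D. u \<in> e}"
        have spoilt: "spoilt ?X J g = spoilt X J g \<union> Sp"
          unfolding spoilt_def loose Sp_def by blast
        have "Sp \<subseteq> (\<Union>e\<in>{e \<in> ?D. e \<inter> X \<noteq> {}}. e \<inter> X)"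
          using assms(5) X(1) by (auto simp: Sp_def)
        hence "card Sp \<le> card (\<Union>e\<in>{e \<in> ?D. e \<inter> X \<noteq> {}}. e \<inter> X)"
          using fin[OF X(2)] by (intro card_mono) auto
        also have "\<dots> \<le> (\<Sum>e\<in>{e \<in> ?D. e \<inter> X \<noteq> {}}. card (e \<inter> X))"
          by (intro card_UN_le) auto
        also have "\<dots> \<le> (\<Sum>e\<in>{e \<in> ?D. e \<inter> X \<noteq> {}}. 1)"
        proof (intro sum_mono)
          fix e assume e: "e \<in> {e \<in> ?D. e \<inter> X \<noteq> {}}"
          hence "e \<in> E" "\<not> e \<subseteq> X" by (auto simp: new_edges_def induced_def)
          then obtain a b where "e = {a, b}" "a \<notin> X" using edge_other by blast
          hence "e \<inter> X \<subseteq> {b}" by auto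
          hence "card (e \<inter> X) \<le> card {b}" by (intro card_mono) auto
          thus "card (e \<inter> X) \<le> 1" by simp
        qed
        finally have "card Sp \<le> 2 * (card ?D - card U)" using 1(2) by simp
        moreover have "card (spoilt ?X J g) \<le> card (spoilt X J g) + card Sp"
          unfolding spoilt by (rule card_Un_le)
        ultimately have "card (spoilt ?X J g) + 2 * card ?X \<le> 2 * card (induced E ?X) + 2"
          using X(9) 1(1) unfolding cardU cardE by (simp add: diff_mult_distrib2)
        moreover have "insert v I' \<subseteq> J \<union> spoilt ?X J g"
          unfolding spoilt using X(10) wvD v(1) by (auto simp: Sp_def)
        moreover have "\<forall>j\<in>J. g j \<subseteq> induced E ?X - F \<and> (\<forall>e\<in>g j. e \<inter> T \<subseteq> {j})"
          using X(8) unfolding D(1) by blast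
        moreover have "J \<subseteq> insert v I'" using X(5) by blast
        ultimately show ?thesis
          using common X(6,7)
          by (intro exI[of _ ?X] exI[of _ J] exI[of _ g] conjI) (elim conjE, assumption)+
      next
        case (2 W)
        define h where "h = g(v := ?D)"
        have h: "h v = ?D" "\<And>j. j \<in> J \<Longrightarrow> h j = g j" "h ` J = g ` J"
          using v(4) by (auto simp: h_def intro!: image_cong)
        have "loose ?X (insert v J) h = loose X J g"
          using gJ D(2,3) unfolding loose_def D(1) by (auto simp: h)
        hence spoilt: "spoilt ?X (insert v J) h = spoilt X J g"
          by (simp add: spoilt_def)
        have "w \<in> V" using edgeD w(2) by blast
        have "h v \<in> pendant v w (tree_wit k V t w)"
          using 2 h(1) by (auto simp: pendant_def insert_commute)
        hence "\<forall>j\<in>insert v J. \<exists>w\<in>V. h j \<in> pendant j w (tree_wit k V t w)"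
          using X(6) h \<open>w \<in> V\<close> by auto
        moreover have "disjoint_family_on h (insert v J)"
        proof -
          have "h v \<inter> h j = {}" if "j \<in> J" for j
            using D(2) X(8) h that by blast
          moreover have "disjoint_family_on h J"
            using X(7) h(2) by (simp add: disjoint_family_on_def)
          ultimately show ?thesis
            using v(4) by (auto simp: disjoint_family_on_insert)
        qed
        moreover have "\<forall>j\<in>insert v J. h j \<subseteq> induced E ?X - F \<and> (\<forall>e\<in>h j. e \<inter> T \<subseteq> {j})"
        proof -
          have "e \<inter> T \<subseteq> {v}" if "e \<in> h v" for e
          proof -
            have "e = {w, v} \<or> e \<in> W" using that h(1) 2(3) by simp
            thus ?thesis using 2(4) w(3) X(1) by blast
          qed
          moreover have "h v \<subseteq> induced E ?X - F" using D h(1) by auto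
          ultimately show ?thesis using X(8) h(2) D(1) by auto
        qed
        moreover have "card (spoilt ?X (insert v J) h) + 2 * card ?X \<le> 2 * card (induced E ?X) + 2"
        proof -
          have "card U \<le> card ?D" using U by blast
          thus ?thesis using X(9) unfolding cardU cardE spoilt by simp
        qed
        moreover have "insert v I' \<subseteq> insert v J \<union> spoilt ?X (insert v J) h"
          unfolding spoilt using X(10) by blast
        moreover have "insert v J \<subseteq> insert v I'" using X(5) by blast
        ultimately show ?thesis
          using common
          by (intro exI[of _ ?X] exI[of _ "insert v J"] exI[of _ h] conjI) (elim conjE, assumption)+
      qed
    qed
  qed
  from this[OF order.refl] obtain X J g where X: "T \<subseteq> X" "X \<subseteq> V"
      "card X \<le> card T + card I * tree_size k t" "connected_in E X" "J \<subseteq> I"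
      "\<forall>j\<in>J. \<exists>w\<in>V. g j \<in> pendant j w (tree_wit k V t w)" "disjoint_family_on g J"
      "\<forall>j\<in>J. g j \<subseteq> induced E X - F \<and> (\<forall>e\<in>g j. e \<inter> T \<subseteq> {j})"
      "card (spoilt X J g) + 2 * card X \<le> 2 * card (induced E X) + 2" "I \<subseteq> J \<union> spoilt X J g"
    by (elim exE conjE) (rule that)
  have "card I \<le> card (J \<union> spoilt X J g)"
    using X(5,10) fI fin_spoilt by (intro card_mono) (auto intro: finite_subset)
  also have "\<dots> \<le> card J + card (spoilt X J g)" by (rule card_Un_le)
  finally have "card I + 2 * card X \<le> card J + 2 * card (induced E X) + 2" using X(9) by linarith
  moreover have "g j \<subseteq> E - F" if "j \<in> J" for j
    using X(8) that by (auto simp: induced_def)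
  ultimately show ?thesis using that X(1-7) by blast
qed

end

section \<open>Breadth-first codes and components of the peeled graph\<close>

text \<open>\<open>ps ! j\<close> is the position of the parent of the vertex at position
  \<open>Suc j\<close>; the root has position 0.\<close>

definition tree_edges :: "'a list \<Rightarrow> nat list \<Rightarrow> 'a set set" where
  "tree_edges xs ps = (\<lambda>j. {xs ! Suc j, xs ! (ps ! j)}) ` {..<length ps}"

definition parent_lists :: "nat \<Rightarrow> nat list set" where
  "parent_lists s = {ps. length ps = s - 1 \<and> sorted ps \<and> (\<forall>j<length ps. ps ! j \<le> j)}"

text \<open>
  Breadth-first search. Since every vertex before a parent already has all its neighbours in the
  list, the parents are found in increasing order; this is what makes the number of codes merely
  exponential in \<open>s\<close>.
\<close>

lemma bfs_list_exists:
  assumes "connected_in E X" "finite X" "1 \<le> s" "s \<le> card X"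
  shows "\<exists>xs ps. length xs = s \<and> distinct xs \<and> set xs \<subseteq> X \<and> ps \<in> parent_lists s \<and>
    tree_edges xs ps \<subseteq> E"
proof -
  have "\<exists>xs ps. length xs = s \<and> distinct xs \<and> set xs \<subseteq> X \<and> ps \<in> parent_lists s \<and>
    tree_edges xs ps \<subseteq> E \<and> (\<forall>p\<in>set ps. \<forall>j<p. \<forall>b\<in>X. {xs ! j, b} \<in> E \<longrightarrow> b \<in> set xs)"
    using assms(3,4)
  proof (induction s rule: dec_induct)
    case base
    then obtain x where "x \<in> X" using assms(2) by fastforce
    thus ?case
      by (intro exI[of _ "[x]"] exI[of _ "[]"]) (auto simp: parent_lists_def tree_edges_def)
  next
    case (step s)
    then obtain xs ps where xs: "length xs = s" "distinct xs" "set xs \<subseteq> X" "ps \<in> parent_lists s"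
      "tree_edges xs ps \<subseteq> E" "\<forall>p\<in>set ps. \<forall>j<p. \<forall>b\<in>X. {xs ! j, b} \<in> E \<longrightarrow> b \<in> set xs"
      by auto
    define P where "P = (\<lambda>a. a < s \<and> (\<exists>b\<in>X. {xs ! a, b} \<in> E \<and> b \<notin> set xs))"
    have "\<exists>a. P a"
    proof (rule ccontr)
      assume *: "\<not> (\<exists>a. P a)"
      have "\<forall>a\<in>set xs. \<forall>b\<in>X. {a, b} \<in> E \<longrightarrow> b \<in> set xs"
        using * xs(1) unfolding P_def by (metis in_set_conv_nth)
      moreover have "set xs \<noteq> {}" using xs(1) step.hyps by auto
      ultimately have "set xs = X" using assms(1) xs(3) unfolding connected_in_def by blast
      thus False using xs(1,2) step.prems distinct_card[OF xs(2)] by simp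
    qed
    \<comment> \<open>The earliest listed vertex with an unlisted neighbour becomes the next parent.
      All vertices before it are exhausted, and no recorded parent comes later.\<close>
    define a where "a = (LEAST a. P a)"
    have "P a" using \<open>\<exists>a. P a\<close> unfolding a_def by (metis LeastI)
    then obtain b where b: "a < s" "b \<in> X" "{xs ! a, b} \<in> E" "b \<notin> set xs" by (auto simp: P_def)
    have a_min: "c \<in> set xs" if "j < a" "c \<in> X" "{xs ! j, c} \<in> E" for j c
      using not_less_Least[OF that(1)[unfolded a_def]] that b(1) by (auto simp: P_def)
    have ps_le: "p \<le> a" if "p \<in> set ps" for p
      using xs(6) that b by (meson not_le)
    have lps: "length ps = s - 1" using xs(4) by (simp add: parent_lists_def)
    have nth: "(xs @ [b]) ! j = xs ! j" if "j < s" for j using that xs(1) by (simp add: nth_append)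
    have "ps @ [a] \<in> parent_lists (Suc s)"
      using xs(4) ps_le b(1) step.hyps
      by (auto simp: parent_lists_def sorted_append nth_append less_Suc_eq)
    moreover have "tree_edges (xs @ [b]) (ps @ [a]) \<subseteq> E"
    proof -
      have "{(xs @ [b]) ! Suc j, (xs @ [b]) ! ((ps @ [a]) ! j)} \<in> E" if "j < length (ps @ [a])" for j
      proof (cases "j = s - 1")
        case True
        thus ?thesis using b step.hyps xs(1) lps nth[of a] by (simp add: nth_append insert_commute)
      next
        case False
        hence j: "j < length ps" "Suc j < s" using that lps by auto
        hence "ps ! j < s" using xs(4) by (force simp: parent_lists_def)
        thus ?thesis
          using j xs(5) nth by (auto simp: tree_edges_def nth_append)
      qed
      thus ?thesis unfolding tree_edges_def by (intro image_subsetI) simp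
    qed
    moreover have "\<forall>p\<in>set (ps @ [a]). \<forall>j<p. \<forall>c\<in>X. {(xs @ [b]) ! j, c} \<in> E \<longrightarrow> c \<in> set (xs @ [b])"
    proof (intro ballI allI impI)
      fix p j c assume *: "p \<in> set (ps @ [a])" "j < p" "c \<in> X" "{(xs @ [b]) ! j, c} \<in> E"
      hence "j < a" using ps_le by fastforce
      hence "c \<in> set xs" using a_min[of j c] * b(1) nth[of j] by simp
      thus "c \<in> set (xs @ [b])" by simp
    qed
    ultimately show ?case
      using xs b by (intro exI[of _ "xs @ [b]"] exI[of _ "ps @ [a]"]) auto
  qed
  thus ?thesis by blast
qed

text \<open>Adding \<open>j\<close> to entry \<open>j\<close> makes a sorted list strictly
  increasing. Such a list is determined by its set of entries, a subset of
  \<open>{..<2 * s}\<close>, and there are \<open>2 ^ (2 * s)\<close> of these.\<close>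

lemma card_parent_lists: "finite (parent_lists s) \<and> card (parent_lists s) \<le> 4 ^ s"
proof -
  define code where "code = (\<lambda>ps. map (\<lambda>j. ps ! j + j) [0..<length ps])"
  have strict: "sorted_wrt (<) (code ps)" if "ps \<in> parent_lists s" for ps
    using that by (auto simp: code_def parent_lists_def sorted_wrt_iff_nth_less
      intro!: add_le_less_mono sorted_nth_mono)
  have "inj_on (\<lambda>ps. set (code ps)) (parent_lists s)"
  proof (rule inj_onI)
    fix ps qs assume *: "ps \<in> parent_lists s" "qs \<in> parent_lists s" "set (code ps) = set (code qs)"
    have eq: "code ps = code qs"
      using strict_sorted_equal[OF strict[OF *(2)] strict[OF *(1)] *(3)] .
    have len: "length ps = s - 1" "length qs = s - 1" using * by (auto simp: parent_lists_def)
    show "ps = qs"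
    proof (rule nth_equalityI)
      fix j assume "j < length ps"
      thus "ps ! j = qs ! j" using arg_cong[OF eq, of "\<lambda>xs. xs ! j"] len by (simp add: code_def)
    qed (simp add: len)
  qed
  moreover have "(\<lambda>ps. set (code ps)) ` parent_lists s \<subseteq> Pow {..<2 * s}"
    by (force simp: code_def parent_lists_def)
  moreover have "card (Pow {..<2 * s}) = 4 ^ s"
    by (simp add: card_Pow power_mult)
  ultimately show ?thesis
    by (metis card_inj_on_le finite_Pow_iff finite_lessThan inj_on_finite)
qed

section \<open>Trees decoded from breadth-first codes\<close>

lemma tree_edges_subset:
  assumes "length xs = s" "ps \<in> parent_lists s" "e \<in> tree_edges xs ps"
  shows "e \<subseteq> set xs"
proof -
  obtain j where "j < s - 1" "e = {xs ! Suc j, xs ! (ps ! j)}" "ps ! j \<le> j"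
    using assms by (auto simp: tree_edges_def parent_lists_def)
  thus ?thesis using assms(1) by auto
qed

lemma card_tree_edges:
  assumes "length xs = s" "distinct xs" "ps \<in> parent_lists s"
  shows "card (tree_edges xs ps) = s - 1"
proof -
  have "inj_on (\<lambda>j. {xs ! Suc j, xs ! (ps ! j)}) {..<length ps}"
  proof (rule inj_onI)
    fix i j assume ij: "i \<in> {..<length ps}" "j \<in> {..<length ps}"
      "{xs ! Suc i, xs ! (ps ! i)} = {xs ! Suc j, xs ! (ps ! j)}"
    have "ps ! i \<le> i" "ps ! j \<le> j" "length ps = s - 1"
      using ij assms(3) by (auto simp: parent_lists_def)
    moreover from this have "xs ! a = xs ! b \<longleftrightarrow> a = b"
      if "a \<in> {Suc i, ps ! i}" "b \<in> {Suc j, ps ! j}" for a b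
      using that ij assms(1,2) by (intro nth_eq_iff_index_eq) auto
    ultimately show "i = j" using ij(3) by (auto simp: doubleton_eq_iff)
  qed
  thus ?thesis using assms(3) by (simp add: tree_edges_def card_image parent_lists_def)
qed

lemma card_tree_edge:
  assumes "length xs = s" "distinct xs" "ps \<in> parent_lists s" "e \<in> tree_edges xs ps"
  shows "card e = 2"
proof -
  obtain j where j: "j < s - 1" "e = {xs ! Suc j, xs ! (ps ! j)}" "ps ! j \<le> j"
    using assms by (auto simp: tree_edges_def parent_lists_def)
  hence "xs ! Suc j \<noteq> xs ! (ps ! j)"
    using assms(1,2) by (subst nth_eq_iff_index_eq) auto
  thus ?thesis using j by simp
qed

lemma tree_edges_cover:
  assumes "length xs = s" "s \<ge> 2" "ps \<in> parent_lists s" "v \<in> set xs"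
  shows "\<exists>e\<in>tree_edges xs ps. v \<in> e"
proof -
  have len: "length ps = s - 1" "\<forall>j<length ps. ps ! j \<le> j" using assms(3) by (auto simp: parent_lists_def)
  obtain i where i: "i < s" "v = xs ! i" using assms(1,4) by (auto simp: in_set_conv_nth)
  define j where "j = i - 1"
  have j: "j < length ps" using i len assms(2) by (auto simp: j_def)
  have "v \<in> {xs ! Suc j, xs ! (ps ! j)}"
  proof (cases "i = 0")
    case True
    moreover have "ps ! j \<le> j" using len(2) j by blast
    ultimately have "ps ! j = 0" by (simp add: j_def)
    thus ?thesis using i True by simp
  next
    case False
    thus ?thesis using i by (simp add: j_def)
  qed
  thus ?thesis using j unfolding tree_edges_def by blast
qed

text \<open>The degrees sum to \<open>2 * (s - 1)\<close>. Each is at least 1, and vertices outside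
  the set contribute at least 3.\<close>

lemma tree_low_degree_vertices:
  assumes "length xs = s" "s \<ge> 2" "distinct xs" "ps \<in> parent_lists s"
  shows "s \<le> 2 * card {v \<in> set xs. card {e \<in> tree_edges xs ps. v \<in> e} \<le> 2}"
proof -
  let ?F = "tree_edges xs ps" and ?T = "set xs"
  define d where "d = (\<lambda>v. card {e \<in> ?F. v \<in> e})"
  define I where "I = {v \<in> ?T. d v \<le> 2}"
  have fin: "finite ?F" by (simp add: tree_edges_def)
  have "(\<Sum>v\<in>?T. d v) = (\<Sum>e\<in>?F. card {v \<in> ?T. v \<in> e})"
    unfolding d_def by (rule sum_multicount_gen) (use fin in auto)
  also have "\<dots> = (\<Sum>e\<in>?F. 2)"
  proof (intro sum.cong refl)
    fix e assume e: "e \<in> ?F"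
    have "{v \<in> ?T. v \<in> e} = e" using tree_edges_subset[OF assms(1,4) e] by auto
    thus "card {v \<in> ?T. v \<in> e} = 2" using card_tree_edge[OF assms(1,3,4) e] by simp
  qed
  also have "\<dots> = 2 * (s - 1)" by (simp add: card_tree_edges[OF assms(1,3,4)])
  finally have sum: "(\<Sum>v\<in>?T. d v) = 2 * (s - 1)" .
  have "d v \<ge> 1" if "v \<in> ?T" for v
  proof -
    have "{e \<in> ?F. v \<in> e} \<noteq> {}" using tree_edges_cover[OF assms(1,2,4) that] by blast
    thus ?thesis using fin by (simp add: d_def Suc_le_eq card_gt_0_iff)
  qed
  hence "(\<Sum>v\<in>?T. if v \<in> I then 1 else 3) \<le> (\<Sum>v\<in>?T. d v)"
    by (intro sum_mono) (auto simp: I_def)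
  moreover have "(\<Sum>v\<in>?T. if v \<in> I then 1 else 3) = card I + 3 * (s - card I)"
  proof -
    have "?T \<inter> I = I" by (auto simp: I_def)
    moreover have "?T \<inter> - I = ?T - I" by auto
    moreover have "card (?T - I) = s - card I"
      using assms by (subst card_Diff_subset) (auto simp: I_def distinct_card)
    ultimately show ?thesis by (simp add: sum.If_cases)
  qed
  ultimately have "card I + 3 * (s - card I) \<le> 2 * (s - 1)" using sum by simp
  hence "s \<le> 2 * card I" by linarith
  thus ?thesis by (simp add: I_def d_def)
qed

section \<open>Peeling, surviving neighbours and components\<close>

lemma peel_subset: "peel k E t \<subseteq> E"
  by (induction t) (auto simp: peel_step_def)

text \<open>Both endpoints of an edge left after round \<open>Suc i\<close> have degree at least
  \<open>k\<close> after round \<open>i\<close>, and the neighbours counted there are endpoints of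
  edges left after round \<open>i\<close>.\<close>

lemma survivors_peel:
  assumes "finite V" "E \<subseteq> all_edges V" "k \<ge> 3"
  shows "survivors k V E (\<lambda>t. \<Union>(peel k E t))"
proof
  fix v i assume "v \<in> \<Union>(peel k E (Suc i))"
  let ?P = "peel k E i"
  have PE: "?P \<subseteq> E" by (rule peel_subset)
  have "\<not> vertex_degree ?P v \<le> k - 1"
    using \<open>v \<in> _\<close> by (auto simp: peel_step_def)
  hence deg: "k \<le> card {e \<in> ?P. v \<in> e}"
    using assms(3) by (simp add: vertex_degree_def)
  have "{e \<in> ?P. v \<in> e} \<subseteq> (\<lambda>w. {v, w}) ` {w \<in> \<Union>?P. {v, w} \<in> E}"
  proof
    fix e assume e: "e \<in> {e \<in> ?P. v \<in> e}"
    hence "card e = 2" using PE assms(2) by (auto simp: all_edges_def)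
    then obtain w where "e = {v, w}" using e by (auto simp: card_2_iff)
    thus "e \<in> (\<lambda>w. {v, w}) ` {w \<in> \<Union>?P. {v, w} \<in> E}" using e PE by blast
  qed
  moreover have fin: "finite {w \<in> \<Union>?P. {v, w} \<in> E}"
    using assms(1,2) by (auto intro!: finite_subset[of _ V] simp: all_edges_def)
  ultimately have "card {e \<in> ?P. v \<in> e} \<le> card {w \<in> \<Union>?P. {v, w} \<in> E}"
    by (meson surj_card_le)
  thus "k \<le> card {w \<in> \<Union>?P. {v, w} \<in> E}" using deg by simp
qed (use assms in auto)

lemma graph_component_properties:
  assumes "C \<in> graph_components V P" "P \<subseteq> all_edges V"
  shows "C \<subseteq> V" and "connected_in P C" and "card C \<ge> 2 \<Longrightarrow> C \<subseteq> \<Union>P"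
proof -
  define R where "R = {(u, v). {u, v} \<in> P}"
  obtain r where r: "r \<in> V" "C = R\<^sup>* `` {r}"
    using assms(1) by (auto simp: graph_components_def R_def quotient_def)
  have "sym R" by (auto simp: R_def sym_def insert_commute)
  hence sym: "(u, v) \<in> R\<^sup>* \<Longrightarrow> (v, u) \<in> R\<^sup>*" for u v by (meson sym_rtrancl symD)
  have RV: "v \<in> V" if "(u, v) \<in> R" for u v using that assms(2) by (auto simp: R_def all_edges_def)
  show "C \<subseteq> V"
  proof
    fix v assume "v \<in> C"
    hence "(r, v) \<in> R\<^sup>*" using r by simp
    thus "v \<in> V" by (cases rule: rtranclE) (use r RV in auto)
  qed
  show "connected_in P C"
    unfolding connected_in_def
  proof (intro allI impI)
    fix Y assume Y: "Y \<subseteq> C" "Y \<noteq> {}" "\<forall>a\<in>Y. \<forall>b\<in>C. {a, b} \<in> P \<longrightarrow> b \<in> Y"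
    then obtain y where y: "y \<in> Y" by blast
    hence "(r, y) \<in> R\<^sup>*" using Y(1) r by auto
    have "z \<in> Y" if "(y, z) \<in> R\<^sup>*" for z
      using that
    proof (induction rule: rtrancl_induct)
      case (step a b)
      have "b \<in> C" using \<open>(r, y) \<in> R\<^sup>*\<close> step.hyps r by (auto intro: rtrancl_trans rtrancl_into_rtrancl)
      thus ?case using Y(3) step by (auto simp: R_def)
    qed (rule y)
    moreover have "(y, z) \<in> R\<^sup>*" if "z \<in> C" for z
      using sym[OF \<open>(r, y) \<in> R\<^sup>*\<close>] that r by (auto intro: rtrancl_trans)
    ultimately show "Y = C" using Y(1) by blast
  qed
  show "C \<subseteq> \<Union>P" if "card C \<ge> 2"
  proof
    fix u assume u: "u \<in> C"
    have "\<not> C \<subseteq> {u}"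
    proof
      assume "C \<subseteq> {u}"
      hence "card C \<le> card {u}" by (intro card_mono) auto
      thus False using that by simp
    qed
    then obtain v where v: "v \<in> C" "v \<noteq> u" by blast
    have "(u, r) \<in> R\<^sup>*" "(r, v) \<in> R\<^sup>*" using sym u v r by auto
    hence "(u, v) \<in> R\<^sup>*" by (rule rtrancl_trans)
    then obtain w where "(u, w) \<in> R" using v(2) by (metis converse_rtranclE)
    thus "u \<in> \<Union>P" by (auto simp: R_def)
  qed
qed

text \<open>A nonempty set closed under adjacency contains the root, by following parents, and then
  every vertex, by returning from parents to children.\<close>

lemma connected_in_bfs_list:
  assumes "length xs = s" "s \<ge> 1" "ps \<in> parent_lists s" "tree_edges xs ps \<subseteq> E"
  shows "connected_in E (set xs)"
  unfolding connected_in_def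
proof (intro allI impI)
  fix Y assume Y: "Y \<subseteq> set xs" "Y \<noteq> {}" "\<forall>a\<in>Y. \<forall>b\<in>set xs. {a, b} \<in> E \<longrightarrow> b \<in> Y"
  have len: "length ps = s - 1" using assms(3) by (simp add: parent_lists_def)
  have edge: "{xs ! Suc j, xs ! (ps ! j)} \<in> E" "ps ! j \<le> j" if "Suc j < s" for j
    using that assms len by (auto simp: tree_edges_def parent_lists_def)
  have down: "xs ! 0 \<in> Y" if "i < s" "xs ! i \<in> Y" for i
    using that
  proof (induction i rule: less_induct)
    case (less i)
    show ?case
    proof (cases i)
      case (Suc j)
      have "xs ! (ps ! j) \<in> Y"
        using Y(3) edge[of j] less.prems Suc assms(1) by auto
      thus ?thesis using less.IH[of "ps ! j"] edge[of j] less.prems Suc by auto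
    qed (use less in simp)
  qed
  have up: "xs ! i \<in> Y" if "i < s" for i
    using that
  proof (induction i rule: less_induct)
    case (less i)
    show ?case
    proof (cases i)
      case 0
      thus ?thesis using Y(1,2) down assms(1) by (metis subset_empty subset_iff equals0I in_set_conv_nth)
    next
      case (Suc j)
      hence "xs ! (ps ! j) \<in> Y" using less edge[of j] by auto
      moreover have "{xs ! (ps ! j), xs ! i} \<in> E" using edge[of j] less.prems Suc by (simp add: insert_commute)
      ultimately show ?thesis using Y(3) less.prems assms(1) by auto
    qed
  qed
  thus "Y = set xs" using Y(1) assms(1) by (auto simp: in_set_conv_nth)
qed

text \<open>A tree on \<open>s\<close> vertices of the component has at least \<open>s / 2\<close>
  vertices of degree at most 2. Attaching witnesses loses at most \<open>2 * m\<close> of them,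
  whence the term \<open>4 * m\<close>.\<close>

lemma large_component_structure:
  assumes "finite V" "E \<subseteq> all_edges V" "k \<ge> 3" "s \<ge> 2"
    and C: "C \<in> graph_components V (peel k E (Suc t))" "card C \<ge> s"
    and excess: "\<And>X. X \<subseteq> V \<Longrightarrow> X \<noteq> {} \<Longrightarrow> connected_in E X \<Longrightarrow> card X \<le> s + s * tree_size k t \<Longrightarrow>
      card (induced E X) + 1 < card X + m"
  obtains xs ps J g where "length xs = s" "distinct xs" "set xs \<subseteq> V" "ps \<in> parent_lists s"
    "tree_edges xs ps \<subseteq> E" "J \<subseteq> set xs" "s \<le> 2 * card J + 4 * m"
    "\<And>j. j \<in> J \<Longrightarrow> \<exists>w\<in>V. g j \<in> pendant j w (tree_wit k V t w)"
    "\<And>j. j \<in> J \<Longrightarrow> g j \<subseteq> E - tree_edges xs ps" "disjoint_family_on g J"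
proof -
  interpret survivors k V E "\<lambda>t. \<Union>(peel k E t)" using assms by (intro survivors_peel)
  let ?P = "peel k E (Suc t)"
  have PE: "?P \<subseteq> E" by (rule peel_subset)
  hence P: "?P \<subseteq> all_edges V" using assms(2) by blast
  note comp = graph_component_properties[OF C(1) P]
  have "finite C" using comp(1) assms(1) finite_subset by blast
  then obtain xs ps where xs: "length xs = s" "distinct xs" "set xs \<subseteq> C" "ps \<in> parent_lists s"
      "tree_edges xs ps \<subseteq> ?P"
    using bfs_list_exists[OF comp(2), of s] C(2) assms(4) by auto
  let ?T = "set xs" and ?F = "tree_edges xs ps"
  define I where "I = {v \<in> ?T. card {e \<in> ?F. v \<in> e} \<le> 2}"
  have FE: "?F \<subseteq> E" using xs(5) PE by blast
  have TV: "?T \<subseteq> V" using xs(3) comp(1) by blast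
  have cardT: "card ?T = s" using xs(1,2) by (simp add: distinct_card)
  have F_ind: "?F \<subseteq> induced E ?T"
    using FE tree_edges_subset[OF xs(1,4)] by (auto simp: induced_def)
  have T_F: "card ?T \<le> card ?F + 1"
    using card_tree_edges[OF xs(1,2,4)] cardT by simp
  have I_P: "I \<subseteq> \<Union>?P"
    using xs(3) comp(3) C(2) assms(4) by (auto simp: I_def)
  obtain X J g where X: "?T \<subseteq> X" "X \<subseteq> V" "card X \<le> card ?T + card I * tree_size k t"
    "connected_in E X" "J \<subseteq> I" "\<And>j. j \<in> J \<Longrightarrow> \<exists>w\<in>V. g j \<in> pendant j w (tree_wit k V t w)"
    "disjoint_family_on g J" "\<And>j. j \<in> J \<Longrightarrow> g j \<subseteq> E - ?F"
    "card I + 2 * card X \<le> card J + 2 * card (induced E X) + 2"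
  proof (rule attach_witnesses[of ?T ?F I t])
    show "connected_in E ?T"
      using connected_in_bfs_list[OF xs(1) _ xs(4) FE] assms(4) by simp
  qed (use TV F_ind T_F I_P in \<open>auto simp: I_def\<close>)
  have "card I \<le> s" unfolding cardT[symmetric] by (intro card_mono) (auto simp: I_def)
  hence "card I * tree_size k t \<le> s * tree_size k t" by (rule mult_le_mono1)
  hence "card X \<le> s + s * tree_size k t" using X(3) cardT by linarith
  moreover have "X \<noteq> {}" using X(1) xs(1) assms(4) by auto
  ultimately have "card (induced E X) + 1 < card X + m"
    using X(2,4) excess by blast
  moreover have "s \<le> 2 * card I"
    unfolding I_def by (rule tree_low_degree_vertices[OF xs(1) assms(4) xs(2,4)])
  ultimately have "s \<le> 2 * card J + 4 * m" using X(9) by linarith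
  moreover have "J \<subseteq> ?T" using X(5) by (auto simp: I_def)
  ultimately show ?thesis
    using that[of xs ps J g] xs TV FE X by blast
qed

section \<open>First moment bounds\<close>

lemma gnp_eq_random_subset: "gnp n p = random_subset (all_edges {..<n}) p"
  by (simp add: gnp_def random_subset_def)

lemma finite_all_edges: "finite V \<Longrightarrow> finite (all_edges V)"
  by (auto simp: all_edges_def)

lemma card_all_edges_le:
  assumes "finite V"
  shows "card (all_edges V) \<le> card V ^ 2"
proof -
  have "all_edges V \<subseteq> (\<lambda>(a, b). {a, b}) ` (V \<times> V)"
    by (auto simp: all_edges_def card_2_iff)
  hence "card (all_edges V) \<le> card (V \<times> V)"
    using assms by (intro surj_card_le) auto
  thus ?thesis by (simp add: power2_eq_square card_cartesian_product)
qed

lemma prob_ex_le: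
  assumes "finite I" "\<And>i. i \<in> I \<Longrightarrow> measure_pmf.prob M {x. P i x} \<le> b"
  shows "measure_pmf.prob M {x. \<exists>i\<in>I. P i x} \<le> real (card I) * b"
proof -
  have "{x. \<exists>i\<in>I. P i x} = (\<Union>i\<in>I. {x. P i x})" by blast
  hence "measure_pmf.prob M {x. \<exists>i\<in>I. P i x} \<le> (\<Sum>i\<in>I. measure_pmf.prob M {x. P i x})"
    using measure_pmf.finite_measure_subadditive_finite[OF assms(1), of "\<lambda>i. {x. P i x}" M] by simp
  also have "\<dots> \<le> (\<Sum>i\<in>I. b)" by (intro sum_mono assms)
  finally show ?thesis by simp
qed

lemma prob_ex_le':
  assumes "finite I" "\<And>i. i \<in> I \<Longrightarrow> measure_pmf.prob M {x. P i x} \<le> b" "real (card I) \<le> a" "0 \<le> b"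
  shows "measure_pmf.prob M {x. \<exists>i\<in>I. P i x} \<le> a * b"
  using prob_ex_le[OF assms(1,2)] mult_right_mono[OF assms(3,4)] by fastforce

lemma prob_random_subset_superset_le:
  assumes "finite A" "0 \<le> p" "p \<le> 1"
  shows "measure_pmf.prob (random_subset A p) {E. F \<subseteq> E} \<le> p ^ card F"
proof (cases "F \<subseteq> A")
  case False
  hence "measure_pmf.prob (random_subset A p) {E. F \<subseteq> E} = 0"
    by (subst measure_pmf_zero_iff) (auto dest: set_pmf_random_subset)
  thus ?thesis using assms by simp
qed (simp add: prob_random_subset_superset assms)

text \<open>The edge and the witness below it occur disjointly, as two events indexed by
  \<open>bool\<close>.\<close>

lemma prob_occurs_pendant:
  assumes "finite A" "0 \<le> p" "p \<le> 1"
  shows "measure_pmf.prob (random_subset A p) {E. occurs (pendant v w \<W>) E} \<le>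
    p * measure_pmf.prob (random_subset A p) {E. occurs \<W> E}"
proof -
  define \<V> where "\<V> = (\<lambda>b. if b then {{{v, w}}} else \<W>)"
  have "occur_disjointly {UNIV} \<V> E" if occ: "occurs (pendant v w \<W>) E" for E
  proof -
    obtain W where "W \<in> \<W>" "{v, w} \<notin> W" "insert {v, w} W \<subseteq> E"
      using occ by (auto simp: occurs_def pendant_def)
    thus ?thesis
      unfolding occur_disjointly_def
      by (intro bexI[of _ UNIV] exI[of _ "\<lambda>b. if b then {{v, w}} else W"])
         (auto simp: \<V>_def disjoint_family_on_def)
  qed
  hence "measure_pmf.prob (random_subset A p) {E. occurs (pendant v w \<W>) E} \<le>
      measure_pmf.prob (random_subset A p) {E. occur_disjointly {UNIV} \<V> E}"
    by (intro measure_pmf.finite_measure_mono) auto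
  also have "\<dots> \<le> (\<Prod>b\<in>UNIV. measure_pmf.prob (random_subset A p) {E. occurs (\<V> b) E})"
    using assms by (intro van_den_Berg_Kesten) auto
  also have "\<dots> = measure_pmf.prob (random_subset A p) {E. {{v, w}} \<subseteq> E} *
      measure_pmf.prob (random_subset A p) {E. occurs \<W> E}"
    by (simp add: UNIV_bool \<V>_def occurs_def)
  also have "\<dots> \<le> p * measure_pmf.prob (random_subset A p) {E. occurs \<W> E}"
    using prob_random_subset_superset_le[OF assms, of "{{v, w}}"] by (intro mult_right_mono) auto
  finally show ?thesis .
qed

text \<open>The finite-\<open>n\<close> form of \<open>\<lambda>\<^sub>t\<close>: each of
  \<open>n\<close> potential children needs its edge and then a witness of depth one less.\<close>

primrec survival_bound :: "nat \<Rightarrow> nat \<Rightarrow> real \<Rightarrow> nat \<Rightarrow> real" where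
  "survival_bound k n p 0 = 1"
| "survival_bound k n p (Suc t) =
     measure_pmf.prob (binomial_pmf n (p * survival_bound k n p t)) {k - 1..}"

lemma survival_bound_bounds: "0 \<le> survival_bound k n p t" "survival_bound k n p t \<le> 1"
  by (cases t; simp)+

text \<open>Induction on the depth: a witness requires at least \<open>k - 1\<close> pendant
  branches to occur disjointly among \<open>n\<close> candidates, to which the binomial bound
  applies.\<close>

lemma prob_occurs_tree_wit:
  assumes "finite V" "card V = n" "finite A" "0 \<le> p" "p \<le> 1"
  shows "measure_pmf.prob (random_subset A p) {E. occurs (tree_wit k V t v) E} \<le> survival_bound k n p t"
proof (induction t arbitrary: v)
  case (Suc t)
  let ?\<W> = "\<lambda>w. pendant v w (tree_wit k V t w)"
  have "occur_disjointly {J. J \<subseteq> V \<and> card J \<ge> k - 1} ?\<W> E"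
    if occ: "occurs (tree_wit k V (Suc t) v) E" for E
  proof -
    obtain f N where "N \<subseteq> V" "card N = k - 1" "\<forall>w\<in>N. f w \<in> ?\<W> w" "disjoint_family_on f N"
        "\<Union>(f ` N) \<subseteq> E"
      using occ by (auto simp: occurs_def)
    thus ?thesis
      unfolding occur_disjointly_def by (intro bexI[of _ N] exI[of _ f]) auto
  qed
  hence "measure_pmf.prob (random_subset A p) {E. occurs (tree_wit k V (Suc t) v) E} \<le>
      measure_pmf.prob (random_subset A p) {E. occur_disjointly {J. J \<subseteq> V \<and> card J \<ge> k - 1} ?\<W> E}"
    by (intro measure_pmf.finite_measure_mono) auto
  also have "\<dots> \<le> measure_pmf.prob (binomial_pmf n (p * survival_bound k n p t)) {k - 1..}"
  proof (rule occur_disjointly_card_le_binomial)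
    fix w
    show "measure_pmf.prob (random_subset A p) {E. occurs (?\<W> w) E} \<le> p * survival_bound k n p t"
      using prob_occurs_pendant[OF assms(3-5), of v w "tree_wit k V t w"]
        mult_left_mono[OF Suc.IH[of w] assms(4)] by linarith
  qed (use assms survival_bound_bounds in \<open>auto intro: mult_le_one\<close>)
  finally show ?case by simp
qed simp

text \<open>One application of the van den Berg--Kesten inequality with \<open>option\<close>
  indices: \<open>None\<close> stands for the tree \<open>F\<close>, \<open>Some j\<close> for the
  witness at \<open>j\<close>. The factor \<open>n\<close> comes from the choice of its first
  neighbour \<open>w\<close>.\<close>

lemma prob_tree_with_witnesses:
  fixes V :: "'a set"
  assumes "finite V" "card V = n" "finite A" "0 \<le> p" "p \<le> 1" "finite J"
  shows "measure_pmf.prob (random_subset A p) {E. F \<subseteq> E \<and> (\<exists>g. disjoint_family_on g J \<and>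
      (\<forall>j\<in>J. (\<exists>w\<in>V. g j \<in> pendant j w (tree_wit k V t w)) \<and> g j \<subseteq> E - F))} \<le>
    p ^ card F * (real n * (p * survival_bound k n p t)) ^ card J"
proof -
  define \<V> where "\<V> = case_option {F} (\<lambda>j. \<Union>w\<in>V. pendant j w (tree_wit k V t w))"
  let ?M = "random_subset A p" and ?b = "p * survival_bound k n p t" and ?J = "insert None (Some ` J)"
  have "occur_disjointly {?J} \<V> E" if F: "F \<subseteq> E" "disjoint_family_on g J"
    "\<forall>j\<in>J. (\<exists>w\<in>V. g j \<in> pendant j w (tree_wit k V t w)) \<and> g j \<subseteq> E - F" for E g
  proof -
    have "disjoint_family_on (case_option F g) ?J"
      using F(2,3) by (auto simp: disjoint_family_on_def)
    moreover have "\<forall>i\<in>?J. case_option F g i \<in> \<V> i \<and> case_option F g i \<subseteq> E"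
      using F(1,3) by (auto simp: \<V>_def)
    ultimately show ?thesis
      unfolding occur_disjointly_def by blast
  qed
  hence "measure_pmf.prob ?M {E. F \<subseteq> E \<and> (\<exists>g. disjoint_family_on g J \<and>
        (\<forall>j\<in>J. (\<exists>w\<in>V. g j \<in> pendant j w (tree_wit k V t w)) \<and> g j \<subseteq> E - F))} \<le>
      measure_pmf.prob ?M {E. occur_disjointly {?J} \<V> E}"
    by (intro measure_pmf.finite_measure_mono) auto
  also have "\<dots> \<le> (\<Prod>i\<in>?J. measure_pmf.prob ?M {E. occurs (\<V> i) E})"
    using assms by (intro van_den_Berg_Kesten) auto
  also have "\<dots> = measure_pmf.prob ?M {E. occurs (\<V> None) E} *
      (\<Prod>j\<in>J. measure_pmf.prob ?M {E. occurs (\<V> (Some j)) E})"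
    using assms(6) by (subst prod.insert) (auto simp: prod.reindex)
  also have "\<dots> \<le> p ^ card F * (\<Prod>j\<in>J. real n * ?b)"
  proof (intro mult_mono prod_mono conjI)
    show "measure_pmf.prob ?M {E. occurs (\<V> None) E} \<le> p ^ card F"
      using prob_random_subset_superset_le[OF assms(3-5), of F] by (simp add: \<V>_def occurs_def)
    fix j
    have "measure_pmf.prob ?M {E. occurs (pendant j w (tree_wit k V t w)) E} \<le> ?b" for w
      using prob_occurs_pendant[OF assms(3-5), of j w "tree_wit k V t w"]
        mult_left_mono[OF prob_occurs_tree_wit[OF assms(1-5)] assms(4)] by (rule order_trans)
    hence "measure_pmf.prob ?M {E. \<exists>w\<in>V. occurs (pendant j w (tree_wit k V t w)) E} \<le> real (card V) * ?b"
      using assms(1) by (intro prob_ex_le)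
    moreover have "{E. occurs (\<V> (Some j)) E} = {E. \<exists>w\<in>V. occurs (pendant j w (tree_wit k V t w)) E}"
      by (auto simp: \<V>_def occurs_def)
    ultimately show "measure_pmf.prob ?M {E. occurs (\<V> (Some j)) E} \<le> real n * ?b"
      using assms(2) by simp
  qed (use assms in \<open>auto intro: prod_nonneg\<close>)
  finally show ?thesis by simp
qed

definition tree_event :: "nat \<Rightarrow> nat \<Rightarrow> nat \<Rightarrow> nat \<Rightarrow> nat \<Rightarrow> nat set set \<Rightarrow> bool" where
  "tree_event k t n s m E \<longleftrightarrow>
    (\<exists>xs\<in>{xs. set xs \<subseteq> {..<n} \<and> length xs = s}. \<exists>ps\<in>parent_lists s. \<exists>J\<in>Pow (set xs).
       distinct xs \<and> s \<le> 2 * card J + 4 * m \<and> tree_edges xs ps \<subseteq> E \<and>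
       (\<exists>g. disjoint_family_on g J \<and> (\<forall>j\<in>J.
         (\<exists>w\<in>{..<n}. g j \<in> pendant j w (tree_wit k {..<n} t w)) \<and> g j \<subseteq> E - tree_edges xs ps)))"

text \<open>There are at most \<open>n ^ s\<close> lists, \<open>4 ^ s\<close> codes and
  \<open>2 ^ s\<close> sets \<open>J\<close>. The square on \<open>\<eta>\<close> makes up for
  \<open>J\<close> having perhaps only about \<open>s / 2\<close> elements:
  \<open>\<eta> ^ (2 * card J) \<le> \<eta> ^ s / \<eta> ^ (4 * m)\<close>.\<close>

lemma prob_tree_event:
  assumes "0 \<le> p" "p \<le> 1" "0 < \<eta>" "\<eta> \<le> 1" "real n * (p * survival_bound k n p t) \<le> \<eta>\<^sup>2"
  shows "measure_pmf.prob (gnp n p) {E. tree_event k t n s m E} \<le>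
    real n ^ s * (4 ^ s * (2 ^ s * (p ^ (s - 1) * (\<eta> ^ s / \<eta> ^ (4 * m)))))"
  unfolding tree_event_def
proof (intro prob_ex_le')
  fix xs ps J
  assume xs: "xs \<in> {xs. set xs \<subseteq> {..<n} \<and> length xs = s}" and ps: "ps \<in> parent_lists s"
    and J: "J \<in> Pow (set xs)"
  let ?F = "tree_edges xs ps"
  let ?E = "{E. distinct xs \<and> s \<le> 2 * card J + 4 * m \<and> ?F \<subseteq> E \<and>
       (\<exists>g. disjoint_family_on g J \<and> (\<forall>j\<in>J.
         (\<exists>w\<in>{..<n}. g j \<in> pendant j w (tree_wit k {..<n} t w)) \<and> g j \<subseteq> E - ?F))}"
  show "measure_pmf.prob (gnp n p) ?E \<le> p ^ (s - 1) * (\<eta> ^ s / \<eta> ^ (4 * m))"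
  proof (cases "distinct xs \<and> s \<le> 2 * card J + 4 * m")
    case True
    have "finite J" using J finite_subset by auto
    have cF: "card ?F = s - 1" using card_tree_edges[of xs s ps] True xs ps by auto
    have "measure_pmf.prob (gnp n p) ?E \<le>
        p ^ card ?F * (real n * (p * survival_bound k n p t)) ^ card J"
      using True assms prob_tree_with_witnesses[of "{..<n}" n "all_edges {..<n}" p J ?F k t]
      by (simp add: gnp_eq_random_subset finite_all_edges \<open>finite J\<close>)
    also have "\<dots> \<le> p ^ (s - 1) * (\<eta>\<^sup>2) ^ card J"
      unfolding cF using assms survival_bound_bounds(1)[of k n p t]
      by (intro mult_left_mono power_mono) auto
    also have "\<dots> \<le> p ^ (s - 1) * (\<eta> ^ s / \<eta> ^ (4 * m))"
    proof (intro mult_left_mono)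
      have "\<eta> ^ (2 * card J + 4 * m) \<le> \<eta> ^ s"
        using True assms by (intro power_decreasing) auto
      moreover have "(\<eta>\<^sup>2) ^ card J = \<eta> ^ (2 * card J)"
        by (rule power_mult[symmetric])
      ultimately show "(\<eta>\<^sup>2) ^ card J \<le> \<eta> ^ s / \<eta> ^ (4 * m)"
        using assms by (simp add: power_add pos_le_divide_eq)
    qed (use assms in auto)
    finally show ?thesis .
  next
    case False
    hence "?E = {}" by blast
    thus ?thesis using assms by (simp only:) simp
  qed
next
  fix xs assume "xs \<in> {xs. set xs \<subseteq> {..<n} \<and> length xs = s}"
  hence "card (Pow (set xs)) \<le> 2 ^ s"
    using card_length[of xs] by (simp add: card_Pow)
  thus "real (card (Pow (set xs))) \<le> 2 ^ s"
    by (metis of_nat_le_iff of_nat_numeral of_nat_power)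
next
  show "real (card (parent_lists s)) \<le> 4 ^ s"
    using card_parent_lists[of s] by (metis of_nat_le_iff of_nat_numeral of_nat_power)
  show "finite {xs. set xs \<subseteq> {..<n} \<and> length xs = s}" by (intro finite_lists_length_eq) auto
  show "real (card {xs. set xs \<subseteq> {..<n} \<and> length xs = s}) \<le> real n ^ s"
    by (subst card_lists_length_eq) auto
qed (use assms card_parent_lists in auto)

text \<open>A connected vertex set with at least \<open>m\<close> edges beyond a spanning tree,
  encoded by a code of that tree and a set \<open>D\<close> of \<open>m\<close> further
  edges.\<close>

definition excess_event :: "nat \<Rightarrow> nat \<Rightarrow> nat \<Rightarrow> nat set set \<Rightarrow> bool" where
  "excess_event n L m E \<longleftrightarrow>
    (\<exists>l\<in>{1..L}. \<exists>xs\<in>{xs. set xs \<subseteq> {..<n} \<and> length xs = l}. \<exists>ps\<in>parent_lists l.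
       \<exists>D\<in>{D. D \<subseteq> all_edges (set xs) \<and> card D = m}.
         distinct xs \<and> tree_edges xs ps \<inter> D = {} \<and> tree_edges xs ps \<union> D \<subseteq> E)"

lemma excess_eventI:
  assumes "E \<subseteq> all_edges {..<n}" "X \<subseteq> {..<n}" "X \<noteq> {}" "connected_in E X" "card X \<le> L"
    and "card X + m \<le> card (induced E X) + 1"
  shows "excess_event n L m E"
proof -
  have fin: "finite X" using assms(2) finite_subset by blast
  hence "1 \<le> card X" using assms(3) by (simp add: Suc_le_eq card_gt_0_iff)
  then obtain xs ps where xs: "length xs = card X" "distinct xs" "set xs \<subseteq> X"
      "ps \<in> parent_lists (card X)" "tree_edges xs ps \<subseteq> E"
    using bfs_list_exists[OF assms(4) fin] by blast
  have X: "set xs = X"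
    using xs fin by (intro card_subset_eq) (auto simp: distinct_card)
  have finE: "finite E" using assms(1) finite_all_edges finite_subset by blast
  have sub: "tree_edges xs ps \<subseteq> induced E X"
    using xs(5) tree_edges_subset[OF xs(1,4)] X by (auto simp: induced_def)
  have "m \<le> card (induced E X - tree_edges xs ps)"
    using assms(6) sub finE \<open>1 \<le> card X\<close>
    by (subst card_Diff_subset)
       (auto simp: card_tree_edges[OF xs(1,2,4)] induced_def intro: finite_subset)
  then obtain D where D: "D \<subseteq> induced E X - tree_edges xs ps" "card D = m"
    by (meson obtain_subset_with_card_n)
  have "D \<subseteq> all_edges (set xs)"
    using D(1) assms(1) X by (auto simp: induced_def all_edges_def)
  moreover have "card X \<in> {1..L}" using \<open>1 \<le> card X\<close> assms(5) by simp
  moreover have "tree_edges xs ps \<inter> D = {}" "tree_edges xs ps \<union> D \<subseteq> E"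
    using D(1) xs(5) by (auto simp: induced_def)
  ultimately show ?thesis
    unfolding excess_event_def using xs X assms(2) D(2) by blast
qed

text \<open>A tree on \<open>l\<close> vertices with \<open>m\<close> further edges has
  \<open>l - 1 + m\<close> edges, against at most \<open>n ^ l\<close> vertex lists. This leaves a
  factor \<open>n / n ^ m\<close>; there are at most \<open>4 ^ l\<close> codes and
  \<open>(L ^ 2) ^ m\<close> sets \<open>D\<close>.\<close>

lemma prob_excess_event:
  assumes "c \<ge> 1" "p \<ge> 0" "p \<le> 1" "real n * p \<le> c" "n > 0"
  shows "measure_pmf.prob (gnp n p) {E. excess_event n L m E} \<le>
    real L * (real n * (4 * c) ^ L * (c * real L ^ 2) ^ m / real n ^ m)"
  unfolding excess_event_def
proof (intro prob_ex_le')
  fix l assume l: "l \<in> {1..L}"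
  have "measure_pmf.prob (gnp n p) {E. \<exists>xs\<in>{xs. set xs \<subseteq> {..<n} \<and> length xs = l}.
       \<exists>ps\<in>parent_lists l. \<exists>D\<in>{D. D \<subseteq> all_edges (set xs) \<and> card D = m}.
         distinct xs \<and> tree_edges xs ps \<inter> D = {} \<and> tree_edges xs ps \<union> D \<subseteq> E} \<le>
     real n ^ l * (4 ^ l * ((real L ^ 2) ^ m * p ^ (l - 1 + m)))"
  proof (intro prob_ex_le')
    fix xs ps D
    assume xs: "xs \<in> {xs. set xs \<subseteq> {..<n} \<and> length xs = l}" and ps: "ps \<in> parent_lists l"
      and D: "D \<in> {D. D \<subseteq> all_edges (set xs) \<and> card D = m}"
    let ?F = "tree_edges xs ps"
    show "measure_pmf.prob (gnp n p) {E. distinct xs \<and> ?F \<inter> D = {} \<and> ?F \<union> D \<subseteq> E} \<le> p ^ (l - 1 + m)"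
    proof (cases "distinct xs \<and> ?F \<inter> D = {}")
      case True
      have "finite D" using D by (auto intro: finite_subset finite_all_edges)
      hence "card (?F \<union> D) = l - 1 + m"
        using True D card_tree_edges[of xs l ps] xs ps
        by (subst card_Un_disjoint) (auto simp: tree_edges_def)
      thus ?thesis
        using True prob_random_subset_superset_le[of "all_edges {..<n}" p "?F \<union> D"] assms
        by (simp add: gnp_eq_random_subset finite_all_edges)
    next
      case False
      hence "{E. distinct xs \<and> ?F \<inter> D = {} \<and> ?F \<union> D \<subseteq> E} = {}" by blast
      thus ?thesis using assms by (simp only:) simp
    qed
  next
    fix xs assume xs: "xs \<in> {xs. set xs \<subseteq> {..<n} \<and> length xs = l}"
    have "card {D. D \<subseteq> all_edges (set xs) \<and> card D = m} = card (all_edges (set xs)) choose m"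
      by (intro n_subsets finite_all_edges) simp
    also have "\<dots> \<le> card (all_edges (set xs)) ^ m"
      by (cases "m \<le> card (all_edges (set xs))") (auto simp: binomial_le_pow binomial_eq_0 not_le)
    also have "\<dots> \<le> (L ^ 2) ^ m"
    proof (intro power_mono)
      have "card (all_edges (set xs)) \<le> card (set xs) ^ 2" by (rule card_all_edges_le) simp
      also have "\<dots> \<le> L ^ 2" using xs l card_length[of xs] by (intro power_mono) auto
      finally show "card (all_edges (set xs)) \<le> L ^ 2" .
    qed simp
    finally show "real (card {D. D \<subseteq> all_edges (set xs) \<and> card D = m}) \<le> (real L ^ 2) ^ m"
      by (metis of_nat_le_iff of_nat_power)
    show "finite {D. D \<subseteq> all_edges (set xs) \<and> card D = m}"
      by (rule finite_subset[of _ "Pow (all_edges (set xs))"]) (auto simp: finite_all_edges)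
  next
    show "real (card (parent_lists l)) \<le> 4 ^ l"
      using card_parent_lists[of l] by (metis of_nat_le_iff of_nat_numeral of_nat_power)
    show "finite {xs. set xs \<subseteq> {..<n} \<and> length xs = l}" by (intro finite_lists_length_eq) auto
    show "real (card {xs. set xs \<subseteq> {..<n} \<and> length xs = l}) \<le> real n ^ l"
      by (subst card_lists_length_eq) auto
  qed (use assms card_parent_lists in auto)
  also have "\<dots> \<le> real n * (4 * c) ^ L * (c * real L ^ 2) ^ m / real n ^ m"
  proof -
    have "(real n * p) ^ (l - 1 + m) \<le> c ^ (l - 1 + m)"
      using assms by (intro power_mono) auto
    also have "\<dots> \<le> c ^ (L + m)"
      using assms l by (intro power_increasing) auto
    finally have 1: "(real n * p) ^ (l - 1 + m) \<le> c ^ (L + m)" .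
    have 2: "(4::real) ^ l \<le> 4 ^ L" using l by (intro power_increasing) auto
    obtain l' where l': "l = Suc l'" using l by (cases l) auto
    have "real n ^ l * (4 ^ l * ((real L ^ 2) ^ m * p ^ (l - 1 + m))) * real n ^ m =
        real n * ((real n * p) ^ (l - 1 + m) * 4 ^ l * (real L ^ 2) ^ m)"
      unfolding l' by (simp add: power_mult_distrib power_add algebra_simps)
    also have "\<dots> \<le> real n * (c ^ (L + m) * 4 ^ L * (real L ^ 2) ^ m)"
      using 1 2 assms by (intro mult_left_mono mult_right_mono mult_mono) auto
    also have "\<dots> = real n * (4 * c) ^ L * (c * real L ^ 2) ^ m"
      by (simp add: power_mult_distrib power_add algebra_simps)
    finally show ?thesis
      using assms(5) by (simp add: field_simps)
  qed
  finally show "measure_pmf.prob (gnp n p) {E. \<exists>xs\<in>{xs. set xs \<subseteq> {..<n} \<and> length xs = l}.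
       \<exists>ps\<in>parent_lists l. \<exists>D\<in>{D. D \<subseteq> all_edges (set xs) \<and> card D = m}.
         distinct xs \<and> tree_edges xs ps \<inter> D = {} \<and> tree_edges xs ps \<union> D \<subseteq> E} \<le>
    real n * (4 * c) ^ L * (c * real L ^ 2) ^ m / real n ^ m" .
qed (use assms in auto)

lemma prob_large_component_le:
  assumes "k \<ge> 3" "s \<ge> 2"
  shows "1 - measure_pmf.prob (gnp n p)
      {E. \<forall>C \<in> graph_components {..<n} (peel k E (Suc t)). card C < s} \<le>
    measure_pmf.prob (gnp n p) {E. tree_event k t n s m E} +
    measure_pmf.prob (gnp n p) {E. excess_event n (s + s * tree_size k t) m E}"
proof -
  let ?M = "gnp n p"
  let ?G = "{E. \<forall>C \<in> graph_components {..<n} (peel k E (Suc t)). card C < s}"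
  have main: "tree_event k t n s m E \<or> excess_event n (s + s * tree_size k t) m E"
    if E: "E \<subseteq> all_edges {..<n}" "E \<notin> ?G" for E
  proof (rule disjCI)
    assume no: "\<not> excess_event n (s + s * tree_size k t) m E"
    obtain C where C: "C \<in> graph_components {..<n} (peel k E (Suc t))" "card C \<ge> s"
      using E(2) by (auto simp: not_less)
    have exc: "card (induced E X) + 1 < card X + m"
      if "X \<subseteq> {..<n}" "X \<noteq> {}" "connected_in E X" "card X \<le> s + s * tree_size k t" for X
      using no excess_eventI[OF E(1) that] by (meson not_le)
    obtain xs ps J g where "length xs = s" "distinct xs" "set xs \<subseteq> {..<n}" "ps \<in> parent_lists s"
      "tree_edges xs ps \<subseteq> E" "J \<subseteq> set xs" "s \<le> 2 * card J + 4 * m"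
      "\<And>j. j \<in> J \<Longrightarrow> \<exists>w\<in>{..<n}. g j \<in> pendant j w (tree_wit k {..<n} t w)"
      "\<And>j. j \<in> J \<Longrightarrow> g j \<subseteq> E - tree_edges xs ps" "disjoint_family_on g J"
      by (rule large_component_structure[OF _ E(1) assms C exc]) auto
    thus "tree_event k t n s m E"
      unfolding tree_event_def by (intro bexI[of _ xs] bexI[of _ ps] bexI[of _ J] conjI exI[of _ g]) auto
  qed
  have "1 - measure_pmf.prob ?M ?G = measure_pmf.prob ?M (UNIV - ?G)"
    using measure_pmf.prob_compl[of ?G ?M] by simp
  also have "\<dots> = measure_pmf.prob ?M ((UNIV - ?G) \<inter> set_pmf ?M)"
    by (simp add: measure_Int_set_pmf)
  also have "\<dots> \<le> measure_pmf.prob ?M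
      ({E. tree_event k t n s m E} \<union> {E. excess_event n (s + s * tree_size k t) m E})"
  proof (intro measure_pmf.finite_measure_mono subsetI)
    fix E assume E: "E \<in> (UNIV - ?G) \<inter> set_pmf ?M"
    hence "E \<subseteq> all_edges {..<n}"
      unfolding gnp_eq_random_subset by (intro set_pmf_random_subset) blast
    thus "E \<in> {E. tree_event k t n s m E} \<union> {E. excess_event n (s + s * tree_size k t) m E}"
      using main[of E] E by blast
  qed simp
  also have "\<dots> \<le> measure_pmf.prob ?M {E. tree_event k t n s m E} +
      measure_pmf.prob ?M {E. excess_event n (s + s * tree_size k t) m E}"
    by (rule measure_Un_le) auto
  finally show ?thesis .
qed

section \<open>The limiting recursion\<close>

text \<open>Closed form of \<open>Pr[Poisson(r) \<ge> m]\<close> for \<open>m > 0\<close>, correct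
  at rate 0 as well because \<open>0 ^ 0 = 1\<close>.\<close>

definition poisson_tail :: "nat \<Rightarrow> real \<Rightarrow> real" where
  "poisson_tail m r = 1 - (\<Sum>i<m. r ^ i / fact i) * exp (- r)"

lemma prob_poisson0_tail:
  assumes "r \<ge> 0" "m > 0"
  shows "measure_pmf.prob (poisson0_pmf r) {j. j \<ge> m} = poisson_tail m r"
proof -
  have "{j. j \<ge> m} = UNIV - {..<m}" by auto
  hence "measure_pmf.prob (poisson0_pmf r) {j. j \<ge> m} = 1 - measure_pmf.prob (poisson0_pmf r) {..<m}"
    using measure_pmf.prob_compl[of "{..<m}" "poisson0_pmf r"] by simp
  also have "measure_pmf.prob (poisson0_pmf r) {..<m} = (\<Sum>i<m. pmf (poisson0_pmf r) i)"
    by (rule measure_measure_pmf_finite) simp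
  also have "\<dots> = (\<Sum>i<m. r ^ i / fact i * exp (- r))"
    using assms(1) by (intro sum.cong) (auto simp: poisson0_pmf_def power_0_left indicator_def)
  finally show ?thesis by (simp add: poisson_tail_def sum_distrib_right)
qed

lemma poisson_tail_nonneg: "r \<ge> 0 \<Longrightarrow> m > 0 \<Longrightarrow> poisson_tail m r \<ge> 0"
  using prob_poisson0_tail[of r m] by (metis measure_nonneg)

lemma poisson_tail_less_1:
  assumes "r \<ge> 0" "m > 0"
  shows "poisson_tail m r < 1"
proof -
  have "(\<Sum>i<m. r ^ i / fact i) > 0"
    using assms by (intro sum_pos2[of _ 0]) auto
  thus ?thesis by (simp add: poisson_tail_def)
qed

lemma continuous_on_poisson_tail [continuous_intros]:
  "continuous_on A f \<Longrightarrow> continuous_on A (\<lambda>x. poisson_tail m (f x))"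
  unfolding poisson_tail_def by (intro continuous_intros) auto

text \<open>Below the threshold there is no positive fixed point. The map is below 1 at
  \<open>x = 1\<close>, so a point with value at least \<open>x\<close> would produce one by the
  intermediate value theorem.\<close>

lemma poisson_tail_less_below_threshold:
  assumes "k \<ge> 3" "0 < c" "c < core_threshold k" "0 < x" "x \<le> 1"
  shows "poisson_tail (k - 1) (c * x) < x"
proof -
  define Fix where "Fix = {x \<in> {0..1}. poisson_tail (k - 1) (c * x) - x = 0}"
  have Fix_iff: "x \<in> {0..1} \<and> x = measure_pmf.prob (poisson0_pmf (c * x)) {j. j \<ge> k - 1} \<longleftrightarrow> x \<in> Fix" for x
    using assms(1,2) by (auto simp: Fix_def prob_poisson0_tail)
  have no_fix: "y \<notin> Fix" if "y > 0" for y
  proof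
    assume y: "y \<in> Fix"
    \<comment> \<open>Compactness provides a largest fixed point, so \<open>GREATEST\<close> in
      \<open>core_beta\<close> is attained. It would be positive, putting \<open>c\<close> at or
      above the infimum.\<close>
    have "compact Fix"
      unfolding Fix_def compact_eq_bounded_closed
    proof
      show "bounded {x \<in> {0..1}. poisson_tail (k - 1) (c * x) - x = 0}"
        by (rule bounded_subset[OF bounded_closed_interval[of 0 1]]) auto
      show "closed {x \<in> {0..1}. poisson_tail (k - 1) (c * x) - x = 0}"
        by (intro continuous_closed_preimage_constant continuous_intros)
    qed
    then obtain b where b: "b \<in> Fix" "\<And>z. z \<in> Fix \<Longrightarrow> z \<le> b"
      using compact_attains_sup[of Fix] y by blast
    have "core_beta k c = b"
      unfolding core_beta_def Fix_iff using b by (intro Greatest_equality) auto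
    hence "c \<in> {c. c > 0 \<and> core_beta k c > 0}"
      using b(2)[OF y] that assms(2) by simp
    moreover have "bdd_below {c. c > 0 \<and> core_beta k c > 0}"
      by (rule bdd_belowI[of _ 0]) auto
    ultimately have "core_threshold k \<le> c"
      unfolding core_threshold_def by (rule cInf_lower)
    thus False using assms(3) by simp
  qed
  show ?thesis
  proof (rule ccontr)
    assume *: "\<not> ?thesis"
    have "\<exists>y\<ge>x. y \<le> 1 \<and> poisson_tail (k - 1) (c * y) - y = 0"
    proof (rule IVT2')
      show "poisson_tail (k - 1) (c * 1) - 1 \<le> 0"
        using poisson_tail_less_1[of "c * 1" "k - 1"] assms(1,2) by simp
      show "continuous_on {x..1} (\<lambda>y. poisson_tail (k - 1) (c * y) - y)"
        by (intro continuous_intros)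
    qed (use * assms in auto)
    then obtain y where "x \<le> y" "y \<le> 1" "poisson_tail (k - 1) (c * y) - y = 0" by blast
    thus False using no_fix[of y] assms(4) by (simp add: Fix_def)
  qed
qed

section \<open>Iteration of the Poisson map from 1\<close>

primrec limit_bound :: "nat \<Rightarrow> real \<Rightarrow> nat \<Rightarrow> real" where
  "limit_bound k c 0 = 1"
| "limit_bound k c (Suc t) = poisson_tail (k - 1) (c * limit_bound k c t)"

lemma limit_bound_bounds:
  assumes "k \<ge> 3" "c > 0"
  shows "0 \<le> limit_bound k c t" "limit_bound k c t \<le> 1"
proof -
  have "0 \<le> limit_bound k c t \<and> limit_bound k c t \<le> 1"
  proof (induction t)
    case (Suc t)
    thus ?case
      using poisson_tail_nonneg[of "c * limit_bound k c t" "k - 1"]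
        poisson_tail_less_1[of "c * limit_bound k c t" "k - 1"] assms by auto
  qed simp
  thus "0 \<le> limit_bound k c t" "limit_bound k c t \<le> 1" by auto
qed

text \<open>The iterates decrease, so by continuity they converge to a fixed point, and positive
  fixed points are excluded.\<close>

lemma limit_bound_tendsto_0:
  assumes "k \<ge> 3" "0 < c" "c < core_threshold k"
  shows "limit_bound k c \<longlonglongrightarrow> 0"
proof -
  note bounds = limit_bound_bounds[OF assms(1,2)]
  have step: "limit_bound k c (Suc t) \<le> limit_bound k c t" for t
  proof (cases "limit_bound k c t = 0")
    case True
    \<comment> \<open>The map sends 0 to 0: only the term \<open>i = 0\<close> of the sum remains,
      and it is 1.\<close>
    have "(\<Sum>i<k - 1. 0 ^ i / fact i) = (1::real)"
      using assms(1) by (subst sum.mono_neutral_right[of _ "{0}"]) auto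
    thus ?thesis using True by (simp add: poisson_tail_def)
  next
    case False
    thus ?thesis
      using poisson_tail_less_below_threshold[OF assms, of "limit_bound k c t"] bounds[of t] by simp
  qed
  hence dec: "decseq (limit_bound k c)" by (intro decseq_SucI)
  obtain l where l: "limit_bound k c \<longlonglongrightarrow> l" "\<And>t. l \<le> limit_bound k c t"
    using decseq_convergent[OF dec, of 0] bounds(1) by blast
  have l01: "0 \<le> l" "l \<le> 1"
    using LIMSEQ_le_const[OF l(1), of 0] l(2)[of 0] bounds(1) by auto
  have "isCont (\<lambda>x. poisson_tail (k - 1) (c * x)) l"
    using continuous_on_eq_continuous_at[of UNIV "\<lambda>x. poisson_tail (k - 1) (c * x)"]
    by (auto intro: continuous_intros)
  hence "(\<lambda>t. poisson_tail (k - 1) (c * limit_bound k c t)) \<longlonglongrightarrow> poisson_tail (k - 1) (c * l)"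
    using l(1) by (rule isCont_tendsto_compose)
  moreover have "(\<lambda>t. poisson_tail (k - 1) (c * limit_bound k c t)) \<longlonglongrightarrow> l"
    using LIMSEQ_Suc[OF l(1)] by simp
  ultimately have "poisson_tail (k - 1) (c * l) = l" by (rule LIMSEQ_unique)
  hence "\<not> 0 < l" using poisson_tail_less_below_threshold[OF assms _ l01(2)] by force
  thus ?thesis using l(1) l01 by simp
qed

section \<open>The Poisson limit of binomial tails\<close>

lemma binomial_div_power_tendsto:
  "(\<lambda>n. real (n choose i) / real n ^ i) \<longlonglongrightarrow> 1 / fact i"
proof (induction i)
  case (Suc i)
  have "(\<lambda>n. (real n - real i) / real n) \<longlonglongrightarrow> 1" by real_asymp
  hence "(\<lambda>n. real (n choose i) / real n ^ i * ((real n - real i) / real n) / real (Suc i)) \<longlonglongrightarrow>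
      1 / fact i * 1 / real (Suc i)"
    by (intro tendsto_intros Suc.IH) auto
  moreover have "real (n choose i) / real n ^ i * ((real n - real i) / real n) / real (Suc i) =
      real (n choose Suc i) / real n ^ Suc i" for n
  proof -
    have "real (Suc i) * real (n choose Suc i) = (real n - real i) * real (n choose i)"
      using gbinomial_mult_1[of "real n" i] by (simp add: binomial_gbinomial algebra_simps)
    hence "real (n choose Suc i) = (real n - real i) * real (n choose i) / real (Suc i)"
      by (simp add: eq_divide_eq mult.commute)
    thus ?thesis by (simp add: mult_ac)
  qed
  ultimately show ?case by (simp add: field_simps)
qed simp

text \<open>Once \<open>q n < 1 / 2\<close>, the logarithm \<open>n * ln (1 - q n)\<close> lies
  between \<open>- n * q n - 2 * n * (q n)\<^sup>2\<close> and \<open>- n * q n\<close>, and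
  \<open>q n\<close> tends to 0.\<close>

lemma power_one_minus_tendsto_exp:
  assumes q: "(\<lambda>n. real n * q n) \<longlonglongrightarrow> r" "\<And>n. q n \<ge> 0"
  shows "(\<lambda>n. (1 - q n) ^ n) \<longlonglongrightarrow> exp (- r)" and "q \<longlonglongrightarrow> 0"
proof -
  have "(\<lambda>n. real n * q n * (1 / real n)) \<longlonglongrightarrow> r * 0"
    by (intro tendsto_mult q) real_asymp
  moreover have ev: "eventually (\<lambda>n. real n * q n * (1 / real n) = q n) sequentially"
    using eventually_gt_at_top[of 0] by eventually_elim simp
  ultimately show q0: "q \<longlonglongrightarrow> 0" by (simp add: tendsto_cong)
  have small: "eventually (\<lambda>n. q n < 1 / 2) sequentially"
    using q0 by (rule order_tendstoD) simp
  have "(\<lambda>n. real n * ln (1 - q n)) \<longlonglongrightarrow> - r"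
  proof (rule tendsto_sandwich)
    show "eventually (\<lambda>n. - (real n * q n) - 2 * (real n * q n * q n) \<le> real n * ln (1 - q n)) sequentially"
      using small
    proof eventually_elim
      case (elim n)
      have "real n * (- q n - 2 * (q n)\<^sup>2) \<le> real n * ln (1 - q n)"
        using ln_one_minus_pos_lower_bound[of "q n"] q(2)[of n] elim by (intro mult_left_mono) auto
      thus ?case by (simp add: algebra_simps power2_eq_square)
    qed
    show "eventually (\<lambda>n. real n * ln (1 - q n) \<le> - (real n * q n)) sequentially"
      using small
    proof eventually_elim
      case (elim n)
      have "real n * ln (1 - q n) \<le> real n * (- q n)"
        using ln_le_minus_one[of "1 - q n"] elim by (intro mult_left_mono) auto
      thus ?case by simp
    qed
    have "(\<lambda>n. - (real n * q n) - 2 * (real n * q n * q n)) \<longlonglongrightarrow> - r - 2 * (r * 0)"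
      by (intro tendsto_intros q(1) q0)
    thus "(\<lambda>n. - (real n * q n) - 2 * (real n * q n * q n)) \<longlonglongrightarrow> - r" by simp
    show "(\<lambda>n. - (real n * q n)) \<longlonglongrightarrow> - r" by (intro tendsto_intros q(1))
  qed
  hence "(\<lambda>n. exp (real n * ln (1 - q n))) \<longlonglongrightarrow> exp (- r)" by (rule tendsto_exp)
  moreover have "eventually (\<lambda>n. exp (real n * ln (1 - q n)) = (1 - q n) ^ n) sequentially"
    using small by eventually_elim (simp add: exp_of_nat_mult)
  ultimately show "(\<lambda>n. (1 - q n) ^ n) \<longlonglongrightarrow> exp (- r)" by (simp add: tendsto_cong)
qed

text \<open>The complement is a sum of the fixed number \<open>m\<close> of terms, each a product of
  factors with known limits.\<close>

lemma binomial_tail_tendsto_poisson_tail: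
  assumes q: "(\<lambda>n. real n * q n) \<longlonglongrightarrow> r" "\<And>n. q n \<ge> 0"
  shows "(\<lambda>n. measure_pmf.prob (binomial_pmf n (q n)) {m..}) \<longlonglongrightarrow> poisson_tail m r"
proof -
  note lim = power_one_minus_tendsto_exp[OF q]
  have small: "eventually (\<lambda>n. q n < 1) sequentially"
    using lim(2) by (rule order_tendstoD) simp
  have "(\<lambda>n. 1 - (\<Sum>i<m. real (n choose i) / real n ^ i * (real n * q n) ^ i *
      ((1 - q n) ^ n / (1 - q n) ^ i))) \<longlonglongrightarrow>
      1 - (\<Sum>i<m. 1 / fact i * r ^ i * (exp (- r) / (1 - 0) ^ i))"
    by (intro tendsto_intros binomial_div_power_tendsto lim q) auto
  moreover have "eventually (\<lambda>n. 1 - (\<Sum>i<m. real (n choose i) / real n ^ i * (real n * q n) ^ i *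
      ((1 - q n) ^ n / (1 - q n) ^ i)) = measure_pmf.prob (binomial_pmf n (q n)) {m..}) sequentially"
    using small eventually_gt_at_top[of m]
  proof eventually_elim
    case (elim n)
    have "{m..} = UNIV - {..<m}" by auto
    hence "measure_pmf.prob (binomial_pmf n (q n)) {m..} =
        1 - measure_pmf.prob (binomial_pmf n (q n)) {..<m}"
      using measure_pmf.prob_compl[of "{..<m}" "binomial_pmf n (q n)"] by simp
    also have "measure_pmf.prob (binomial_pmf n (q n)) {..<m} = (\<Sum>i<m. pmf (binomial_pmf n (q n)) i)"
      by (rule measure_measure_pmf_finite) simp
    also have "\<dots> = (\<Sum>i<m. real (n choose i) / real n ^ i * (real n * q n) ^ i *
      ((1 - q n) ^ n / (1 - q n) ^ i))"
    proof (intro sum.cong refl)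
      fix i assume "i \<in> {..<m}"
      hence "(1 - q n) ^ (n - i) = (1 - q n) ^ n / (1 - q n) ^ i"
        using elim by (intro power_diff) auto
      thus "pmf (binomial_pmf n (q n)) i = real (n choose i) / real n ^ i * (real n * q n) ^ i *
          ((1 - q n) ^ n / (1 - q n) ^ i)"
        using elim q(2)[of n] by (simp add: power_mult_distrib)
    qed
    finally show ?case by simp
  qed
  moreover have "1 - (\<Sum>i<m. 1 / fact i * r ^ i * (exp (- r) / (1 - 0) ^ i)) = poisson_tail m r"
    by (simp add: poisson_tail_def sum_distrib_right)
  ultimately show ?thesis by (simp add: tendsto_cong)
qed

lemma survival_bound_tendsto:
  assumes "k \<ge> 3" "c > 0"
  shows "(\<lambda>n. survival_bound k n (c / real n) t) \<longlonglongrightarrow> limit_bound k c t"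
proof (induction t)
  case (Suc t)
  have "(\<lambda>n. c * survival_bound k n (c / real n) t) \<longlonglongrightarrow> c * limit_bound k c t"
    by (intro tendsto_intros Suc.IH)
  moreover have "eventually (\<lambda>n. c * survival_bound k n (c / real n) t =
      real n * (c / real n * survival_bound k n (c / real n) t)) sequentially"
    using eventually_gt_at_top[of 0] by eventually_elim simp
  ultimately have "(\<lambda>n. real n * (c / real n * survival_bound k n (c / real n) t)) \<longlonglongrightarrow>
      c * limit_bound k c t"
    by (rule Lim_transform_eventually)
  thus ?case
    using assms survival_bound_bounds
    by (simp del: times_divide_eq_left) (intro binomial_tail_tendsto_poisson_tail, auto)
qed simp

section \<open>Small components\<close>

text \<open>The constant is chosen so that \<open>8 * b * \<eta> = exp (- 2)\<close>, where 8 counts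
  codes and sets \<open>J\<close>. The union bound is then at most a constant times
  \<open>n * exp (- 2 * s n)\<close>, and \<open>s n \<ge> ln n\<close> turns this into
  \<open>1 / n\<close>.\<close>

lemma prob_tree_event_tendsto_0:
  assumes "0 < c" "c \<le> b" "1 \<le> b" "\<eta> = exp (- 2) / (8 * b)"
    and "eventually (\<lambda>n. c * survival_bound k n (c / real n) t \<le> \<eta>\<^sup>2) sequentially"
    and "\<And>n. ln (real n) \<le> real (s n)" "\<And>n. s n > 0"
  shows "(\<lambda>n. measure_pmf.prob (gnp n (c / real n)) {E. tree_event k t n (s n) m E}) \<longlonglongrightarrow> 0"
proof (rule tendsto_sandwich[of "\<lambda>_. 0"])
  have \<eta>: "0 < \<eta>" "\<eta> \<le> 1" "8 * b * \<eta> = exp (- 2)"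
  proof -
    have "exp (- 2) \<le> (1::real)" by simp
    hence "exp (- 2) \<le> 8 * b" using assms(3) by linarith
    thus "0 < \<eta>" "\<eta> \<le> 1" "8 * b * \<eta> = exp (- 2)" unfolding assms(4) using assms(3) by simp_all
  qed
  show "eventually (\<lambda>n. measure_pmf.prob (gnp n (c / real n)) {E. tree_event k t n (s n) m E} \<le>
      1 / \<eta> ^ (4 * m) * (1 / real n)) sequentially"
    using assms(5) eventually_gt_at_top[of 0] eventually_ge_at_top[of "nat \<lceil>c\<rceil>"]
  proof eventually_elim
    case (elim n)
    have n: "real n > 0" "c \<le> real n" using elim by linarith+
    obtain s' where s': "s n = Suc s'" using assms(7)[of n] by (cases "s n") auto
    have "measure_pmf.prob (gnp n (c / real n)) {E. tree_event k t n (s n) m E} \<le>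
        real n ^ s n * (4 ^ s n * (2 ^ s n * ((c / real n) ^ (s n - 1) * (\<eta> ^ s n / \<eta> ^ (4 * m)))))"
      using assms(1) n \<eta> elim by (intro prob_tree_event) (auto simp: field_simps)
    also have "\<dots> = real n * (c ^ (s n - 1) * (8 * \<eta>) ^ s n) / \<eta> ^ (4 * m)"
    proof -
      have "real n ^ s' * (c / real n) ^ s' = c ^ s'"
        using n by (simp flip: power_mult_distrib)
      moreover have "(4::real) ^ s' * 2 ^ s' = 8 ^ s'" by (simp flip: power_mult_distrib)
      moreover have "real n ^ s' * (4 ^ s' * (2 ^ s' * (c / real n) ^ s')) =
          (real n ^ s' * (c / real n) ^ s') * (4 ^ s' * 2 ^ s')"
        by (simp only: mult_ac)
      ultimately show ?thesis unfolding s' by (simp add: power_mult_distrib)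
    qed
    also have "\<dots> \<le> real n * (b ^ s n * (8 * \<eta>) ^ s n) / \<eta> ^ (4 * m)"
    proof -
      have "c ^ (s n - 1) \<le> b ^ (s n - 1)" using assms by (intro power_mono) auto
      also have "\<dots> \<le> b ^ s n" using assms by (intro power_increasing) auto
      finally show ?thesis
        using \<eta> by (intro divide_right_mono mult_left_mono mult_right_mono) auto
    qed
    also have "b ^ s n * (8 * \<eta>) ^ s n = exp (- 2) ^ s n"
      unfolding \<eta>(3)[symmetric] by (simp only: power_mult_distrib mult_ac)
    also have "\<dots> = exp (- 2 * real (s n))"
      by (simp add: exp_of_nat_mult[symmetric] mult.commute)
    also have "real n * exp (- 2 * real (s n)) / \<eta> ^ (4 * m) \<le>
        real n * exp (- 2 * ln (real n)) / \<eta> ^ (4 * m)"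
      using \<eta> assms(6)[of n] by (intro divide_right_mono mult_left_mono) auto
    also have "exp (- 2 * ln (real n)) = 1 / (real n * real n)"
    proof -
      have "exp (- 2 * ln (real n)) = inverse (exp (ln (real n) + ln (real n)))"
        by (subst exp_minus[symmetric]) simp
      thus ?thesis using n by (simp only: exp_add exp_ln inverse_eq_divide)
    qed
    finally show ?case using n by (simp add: field_simps)
  qed
  have "(\<lambda>n. 1 / \<eta> ^ (4 * m) * (1 / real n)) \<longlonglongrightarrow> 1 / \<eta> ^ (4 * m) * 0"
    by (intro tendsto_mult tendsto_const) real_asymp
  thus "(\<lambda>n. 1 / \<eta> ^ (4 * m) * (1 / real n)) \<longlonglongrightarrow> 0" by simp
qed (auto)

text \<open>For logarithmic \<open>L\<close> the factor \<open>(4 * b) ^ L\<close> is at most a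
  constant times \<open>n powr (K * ln (4 * b))\<close>. The lower bound on \<open>m\<close> leaves
  at most \<open>n powr (- 2)\<close> against powers of \<open>ln n\<close>.\<close>

lemma prob_excess_event_tendsto_0:
  assumes "0 < c" "c \<le> b" "1 \<le> b" "real K * ln (4 * b) + 3 \<le> real m"
    and "\<And>n. n > 0 \<Longrightarrow> real (L n) \<le> real K * (ln (real n) + 3)"
  shows "(\<lambda>n. measure_pmf.prob (gnp n (c / real n)) {E. excess_event n (L n) m E}) \<longlonglongrightarrow> 0"
proof (rule tendsto_sandwich[of "\<lambda>_. 0"])
  define B where "B = real K ^ (2 * m + 1) * (exp (3 * (real K * ln (4 * b))) * b ^ m)"
  show "eventually (\<lambda>n. measure_pmf.prob (gnp n (c / real n)) {E. excess_event n (L n) m E} \<le>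
      B * ((ln (real n) + 3) ^ (2 * m + 1) / real n ^ 2)) sequentially"
    using eventually_gt_at_top[of 0] eventually_ge_at_top[of "nat \<lceil>c\<rceil>"]
  proof eventually_elim
    case (elim n)
    have n: "real n \<ge> 1" "c \<le> real n" using elim by linarith+
    have L: "real (L n) \<le> real K * (ln (real n) + 3)" using assms(5) elim by blast
    have lnb: "ln (4 * b) \<ge> 0" using assms(3) by simp
    have "measure_pmf.prob (gnp n (c / real n)) {E. excess_event n (L n) m E} \<le>
        real (L n) * (real n * (4 * b) ^ L n * (b * real (L n) ^ 2) ^ m / real n ^ m)"
      using assms n by (intro prob_excess_event) auto
    also have "\<dots> = real (L n) ^ (2 * m + 1) * (4 * b) ^ L n * b ^ m * (real n / real n ^ m)"
      by (simp add: power_mult_distrib mult_ac flip: power_mult)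
    also have "\<dots> \<le> (real K * (ln (real n) + 3)) ^ (2 * m + 1) *
        (exp (3 * (real K * ln (4 * b))) * real n powr (real K * ln (4 * b))) * b ^ m * (real n / real n ^ m)"
    proof (intro mult_right_mono mult_mono power_mono L)
      have "(4 * b) ^ L n = exp (real (L n) * ln (4 * b))"
        using assms(3) by (simp add: exp_of_nat_mult)
      also have "\<dots> \<le> exp (real K * (ln (real n) + 3) * ln (4 * b))"
        using L lnb by (intro iffD2[OF exp_le_cancel_iff] mult_right_mono) auto
      also have "\<dots> = exp (3 * (real K * ln (4 * b))) * real n powr (real K * ln (4 * b))"
        using n by (simp add: powr_def algebra_simps flip: exp_add)
      finally show "(4 * b) ^ L n \<le> exp (3 * (real K * ln (4 * b))) * real n powr (real K * ln (4 * b))" .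
    qed (use assms n in auto)
    also have "\<dots> = B * (ln (real n) + 3) ^ (2 * m + 1) *
        (real n powr (real K * ln (4 * b)) * (real n / real n ^ m))"
      by (simp add: B_def power_mult_distrib mult_ac)
    also have "real n powr (real K * ln (4 * b)) * (real n / real n ^ m) =
        real n powr (real K * ln (4 * b) + 1 - real m)"
      using n by (simp add: powr_diff powr_add powr_realpow)
    also have "B * (ln (real n) + 3) ^ (2 * m + 1) * real n powr (real K * ln (4 * b) + 1 - real m) \<le>
        B * (ln (real n) + 3) ^ (2 * m + 1) * real n powr (- 2)"
      using n assms(3,4) by (intro mult_left_mono powr_mono) (auto simp: B_def)
    also have "real n powr (- 2) = 1 / real n ^ 2"
      using n by (simp add: powr_minus_divide)
    finally show ?case by simp
  qed
  have "(\<lambda>n. (ln (real n) + 3) ^ (2 * m + 1) / real n ^ 2) \<longlonglongrightarrow> 0"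
    by real_asymp
  hence "(\<lambda>n. B * ((ln (real n) + 3) ^ (2 * m + 1) / real n ^ 2)) \<longlonglongrightarrow> B * 0"
    by (intro tendsto_mult tendsto_const)
  thus "(\<lambda>n. B * ((ln (real n) + 3) ^ (2 * m + 1) / real n ^ 2)) \<longlonglongrightarrow> 0" by simp
qed auto

theorem theorem4:
  fixes k :: nat and c :: real
  assumes "k \<ge> 3" and "0 < c" and "c < core_threshold k"
  shows "\<exists>t :: nat. \<exists>f :: nat \<Rightarrow> real.
    f \<in> o(\<lambda>n. (ln (real n)) ^ 3) \<and>
    (\<lambda>n. measure_pmf.prob (gnp n (c / real n))
       {E. \<forall>C \<in> graph_components {..<n} (peel k E t). real (card C) \<le> f n}) \<longlonglongrightarrow> 1"
proof -
  define b where "b = max 1 c"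
  define \<eta> where "\<eta> = exp (- 2) / (8 * b)"
  have b: "1 \<le> b" "c \<le> b" by (auto simp: b_def)
  hence "0 < \<eta>" by (simp add: \<eta>_def)
  \<comment> \<open>The depth \<open>t\<close> is fixed once the limiting recursion is below the
    tolerance \<open>\<eta>\<^sup>2\<close>; the finite-\<open>n\<close> bound follows for large
    \<open>n\<close>. One more round of peeling gives \<open>Suc t\<close>.\<close>
  have "(\<lambda>t. c * limit_bound k c t) \<longlonglongrightarrow> c * 0"
    by (intro tendsto_intros limit_bound_tendsto_0 assms)
  hence "eventually (\<lambda>t. c * limit_bound k c t < \<eta>\<^sup>2) sequentially"
    using \<open>0 < \<eta>\<close> by (intro order_tendstoD) auto
  then obtain t where t: "c * limit_bound k c t < \<eta>\<^sup>2"
    by (auto simp: eventually_sequentially)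
  have "(\<lambda>n. c * survival_bound k n (c / real n) t) \<longlonglongrightarrow> c * limit_bound k c t"
    by (intro tendsto_intros survival_bound_tendsto assms)
  from order_tendstoD(2)[OF this t]
  have surv: "eventually (\<lambda>n. c * survival_bound k n (c / real n) t \<le> \<eta>\<^sup>2) sequentially"
    by eventually_elim simp
  \<comment> \<open>A tree on \<open>s n\<close> vertices together with its witnesses has at most
    \<open>K * s n\<close> vertices; \<open>m\<close> is then taken large enough for this
    \<open>K\<close>.\<close>
  define K where "K = 1 + tree_size k t"
  define m where "m = nat \<lceil>real K * ln (4 * b)\<rceil> + 3"
  \<comment> \<open>Rounding up gives \<open>s n \<ge> ln n\<close>, and the summand 2 ensures
    \<open>s n \<ge> 2\<close> for every \<open>n\<close>.\<close>
  define s where "s = (\<lambda>n. nat \<lceil>ln (real n)\<rceil> + 2)"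
  have s_ge: "ln (real n) \<le> real (s n)" for n unfolding s_def by linarith
  have s_le: "real (s n) \<le> ln (real n) + 3" if "n > 0" for n
    using ln_ge_zero[of "real n"] that unfolding s_def by linarith
  \<comment> \<open>For \<open>n > 0\<close> this bounds \<open>s n\<close>, hence every component
    with fewer than \<open>s n\<close> vertices.\<close>
  define f where "f = (\<lambda>n. ln (real n) + 3)"
  let ?P = "\<lambda>n. measure_pmf.prob (gnp n (c / real n))"
  let ?G = "\<lambda>n. {E. \<forall>C \<in> graph_components {..<n} (peel k E (Suc t)). real (card C) \<le> f n}"
  have tree: "(\<lambda>n. ?P n {E. tree_event k t n (s n) m E}) \<longlonglongrightarrow> 0"
    using assms(2) b surv s_ge by (intro prob_tree_event_tendsto_0[of c b \<eta>]) (auto simp: \<eta>_def s_def)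
  have "real (s n + s n * tree_size k t) \<le> real K * (ln (real n) + 3)" if "n > 0" for n
    using mult_left_mono[OF s_le[OF that], of "real K"] by (simp add: K_def algebra_simps)
  hence excess: "(\<lambda>n. ?P n {E. excess_event n (s n + s n * tree_size k t) m E}) \<longlonglongrightarrow> 0"
    using assms(2) b by (intro prob_excess_event_tendsto_0[of c b K]) (auto simp: m_def)
  have "(\<lambda>n. ?P n (?G n)) \<longlonglongrightarrow> 1"
  proof (rule tendsto_sandwich)
    show "eventually (\<lambda>n. 1 - (?P n {E. tree_event k t n (s n) m E} +
        ?P n {E. excess_event n (s n + s n * tree_size k t) m E}) \<le> ?P n (?G n)) sequentially"
      using eventually_gt_at_top[of 0]
    proof eventually_elim
      case (elim n)
      have "?P n {E. \<forall>C \<in> graph_components {..<n} (peel k E (Suc t)). card C < s n} \<le> ?P n (?G n)"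
        using s_le[OF elim] by (intro measure_pmf.finite_measure_mono) (fastforce simp: f_def)+
      thus ?case
        using prob_large_component_le[OF assms(1), of "s n" n "c / real n" t m] by (simp add: s_def)
    qed
    have "(\<lambda>n. 1 - (?P n {E. tree_event k t n (s n) m E} +
        ?P n {E. excess_event n (s n + s n * tree_size k t) m E})) \<longlonglongrightarrow> 1 - (0 + 0)"
      by (intro tendsto_intros tree excess)
    thus "(\<lambda>n. 1 - (?P n {E. tree_event k t n (s n) m E} +
        ?P n {E. excess_event n (s n + s n * tree_size k t) m E})) \<longlonglongrightarrow> 1" by simp
  qed auto
  moreover have "f \<in> o(\<lambda>n. ln (real n) ^ 3)"
    unfolding f_def by real_asymp
  ultimately show ?thesis by blast
qed

end
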